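(* For all positive invertible bounded operators $A,B$ on a Hilbert space and every Kubo-Ando mean $\sigma$, $$\delta(A,A\sigma B)\le\delta(A,B),$$ where $\delta(A,B)=\|\log(A^{-1/2}BA^{-1/2})\|_2$ is the trace metric distance.
   Context: "Positive" means self-adjoint and positive semidefinite, and $X\le Y$ means that $Y-X$ is positive. $\|X\|_2=(\operatorname{Tr}[X^*X])^{1/2}$ is the Hilbert-Schmidt norm, taken to be $+\infty$ if $X$ is not Hilbert-Schmidt (in finite dimension it is always finite). A Kubo-Ando mean is a binary operation $(A,B)\mapsto A\sigma B$ on and into the positive operators satisfying, for all positive operators $A,B,C,D$: (1) Closure: $A\sigma B\ge 0$; (2) Monotonicity: $A\le C$ and $B\le D$ imply $A\sigma B\le C\sigma D$; (3) Transformer inequality: $C(A\sigma B)C\le (CAC)\sigma(CBC)$; (4) Continuity: if $A_n\downarrow A$ and $B_n\downarrow B$ then $(A_n\sigma B_n)\downarrow (A\sigma B)$, where $A_n\downarrow A$ means that $A_1\ge A_2\ge\cdots$ are positive operators converging strongly to $A$; (5) Normalisation: $I\sigma I=I$, with $I$ the identity operator. By the known Kubo-Ando correspondence (established for operators on an infinite-dimensional Hilbert space; in finite dimension Kubo-Ando means are understood as given by the same formula), these means are exactly those given, for invertible $A$, by $$A\sigma B=A^{1/2}f(A^{-1/2}BA^{-1/2})A^{1/2},$$ where $f$ is a non-negative operator monotone function on $(0,+\infty)$ with $f(1)=1$. Equivalently, for positive invertible $A,B$, $$A\sigma B=\int_{[0,1]}(tA^{-1}+(1-t)B^{-1})^{-1}\,d\nu(t)$$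 for a probability measure $\nu$ on $[0,1]$. *)

theory Defs
  imports
    "HOL-Analysis.Analysis"
    "HOL-Computational_Algebra.Polynomial"
    "Jordan_Normal_Form.Schur_Decomposition"
begin

text \<open>A complex inner product space is presented over its underlying real inner product space, so
  norm, topology and completeness are those of the library. The complex inner product is linear in
  its second argument; positivity of \<open>cinner x x\<close> follows from \<open>Re_cinner\<close> and \<open>cinner_commute\<close>.\<close>

class complex_inner = real_inner +
  fixes scaleC :: "complex \<Rightarrow> 'a \<Rightarrow> 'a" (infixr "*\<^sub>C" 75)
    and cinner :: "'a \<Rightarrow> 'a \<Rightarrow> complex"
  assumes scaleC_add_right: "c *\<^sub>C (x + y) = c *\<^sub>C x + c *\<^sub>C y"
    and scaleC_add_left: "(c + d) *\<^sub>C x = c *\<^sub>C x + d *\<^sub>C x"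
    and scaleC_scaleC: "c *\<^sub>C d *\<^sub>C x = (c * d) *\<^sub>C x"
    and scaleC_of_real: "complex_of_real r *\<^sub>C x = r *\<^sub>R x"
    and cinner_commute: "cinner x y = cnj (cinner y x)"
    and cinner_add_right: "cinner x (y + z) = cinner x y + cinner x z"
    and cinner_scaleC_right: "cinner x (c *\<^sub>C y) = c * cinner x y"
    and Re_cinner: "Re (cinner x y) = inner x y"

class complex_hilbert = complex_inner + complete_space

instantiation complex :: complex_hilbert
begin
definition scaleC_complex :: "complex \<Rightarrow> complex \<Rightarrow> complex" where
  "scaleC_complex c x = c * x"
definition cinner_complex :: "complex \<Rightarrow> complex \<Rightarrow> complex" where
  "cinner_complex x y = cnj x * y"
instance
  by standard
    (auto simp: scaleC_complex_def cinner_complex_def inner_complex_def scaleR_conv_of_real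
      algebra_simps)
end

text \<open>For a complex space, real and complex finite-dimensionality coincide, so the (real) \<open>span\<close>
  of the library suffices.\<close>

definition finite_dim :: "'a::complex_hilbert itself \<Rightarrow> bool" where
  "finite_dim _ \<longleftrightarrow> (\<exists>S :: 'a set. finite S \<and> span S = UNIV)"

definition is_onb :: "'a::complex_hilbert set \<Rightarrow> bool" where
  "is_onb E \<longleftrightarrow>
     (\<forall>e\<in>E. \<forall>e'\<in>E. cinner e e' = (if e = e' then 1 else 0)) \<and>
     (\<forall>x. (\<forall>e\<in>E. cinner e x = 0) \<longrightarrow> x = 0)"

text \<open>Elements of \<open>'a \<Rightarrow>\<^sub>L 'a\<close> are only real-linear; the bounded operators on the Hilbert space are
  those satisfying \<open>clinear_op\<close>.\<close>

type_synonym 'a op = "'a \<Rightarrow>\<^sub>L 'a"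

definition clinear_op :: "'a::complex_hilbert op \<Rightarrow> bool" where
  "clinear_op T \<longleftrightarrow> (\<forall>c x. blinfun_apply T (c *\<^sub>C x) = c *\<^sub>C blinfun_apply T x)"

definition selfadjoint :: "'a::complex_hilbert op \<Rightarrow> bool" where
  "selfadjoint T \<longleftrightarrow> clinear_op T \<and>
     (\<forall>x y. cinner (blinfun_apply T x) y = cinner x (blinfun_apply T y))"

definition positive_op :: "'a::complex_hilbert op \<Rightarrow> bool" where
  "positive_op T \<longleftrightarrow> selfadjoint T \<and> (\<forall>x. 0 \<le> Re (cinner x (blinfun_apply T x)))"

definition op_le :: "'a::complex_hilbert op \<Rightarrow> 'a op \<Rightarrow> bool" (infix "\<sqsubseteq>" 50) where
  "X \<sqsubseteq> Y \<longleftrightarrow> positive_op (Y - X)"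

definition op_invertible :: "'a::complex_hilbert op \<Rightarrow> bool" where
  "op_invertible T \<longleftrightarrow> (\<exists>S. S o\<^sub>L T = id_blinfun \<and> T o\<^sub>L S = id_blinfun)"

definition op_adjoint :: "'a::complex_hilbert op \<Rightarrow> 'a op" where
  "op_adjoint T =
     (THE S. \<forall>x y. cinner (blinfun_apply S x) y = cinner x (blinfun_apply T y))"

text \<open>The calculus is used for self-adjoint operators only. Their spectrum is real, so it is enough
  to record its real points.\<close>

definition op_spectrum :: "'a::complex_hilbert op \<Rightarrow> real set" where
  "op_spectrum T = {r. \<not> op_invertible (T - r *\<^sub>R id_blinfun)}"

definition poly_op :: "real poly \<Rightarrow> 'a::complex_hilbert op \<Rightarrow> 'a op" where
  "poly_op p T = (\<Sum>i\<le>degree p. coeff p i *\<^sub>R (((o\<^sub>L) T ^^ i) id_blinfun))"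

text \<open>\<open>cfc f T\<close> is the operator \<open>f(T)\<close>, for \<open>f\<close> continuous on the spectrum of the self-adjoint
  operator \<open>T\<close>: the norm limit of \<open>p\<^sub>n(T)\<close> for polynomials \<open>p\<^sub>n\<close> converging to \<open>f\<close> uniformly on the
  spectrum.\<close>

definition cfc :: "(real \<Rightarrow> real) \<Rightarrow> 'a::complex_hilbert op \<Rightarrow> 'a op" where
  "cfc f T = (THE S. \<forall>p :: nat \<Rightarrow> real poly.
     uniform_limit (op_spectrum T) (\<lambda>n. poly (p n)) f sequentially \<longrightarrow>
     (\<lambda>n. poly_op (p n) T) \<longlonglongrightarrow> S)"

definition op_powr :: "'a::complex_hilbert op \<Rightarrow> real \<Rightarrow> 'a op" where
  "op_powr T r = cfc (\<lambda>x. x powr r) T"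

definition op_log :: "'a::complex_hilbert op \<Rightarrow> 'a op" where
  "op_log T = cfc ln T"

text \<open>Trace of a positive operator, possibly infinite; it does not depend on the chosen basis.\<close>

definition op_trace :: "'a::complex_hilbert op \<Rightarrow> ennreal" where
  "op_trace T =
     infsum (\<lambda>e. ennreal (Re (cinner e (blinfun_apply T e)))) (SOME E. is_onb E)"

definition hs_norm :: "'a::complex_hilbert op \<Rightarrow> ennreal" where
  "hs_norm X =
     (let t = op_trace (op_adjoint X o\<^sub>L X)
      in if t = \<infinity> then \<infinity> else ennreal (sqrt (enn2real t)))"

definition trace_dist :: "'a::complex_hilbert op \<Rightarrow> 'a op \<Rightarrow> ennreal" where
  "trace_dist A B = hs_norm (op_log (op_powr A (-1/2) o\<^sub>L B o\<^sub>L op_powr A (-1/2)))"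

text \<open>A function on \<open>(0,\<infinity>)\<close> is operator monotone if it is monotone on the positive definite
  complex matrices of every order. Values of \<open>f\<close> outside \<open>(0,\<infinity>)\<close> play no role.\<close>

definition unitary_mat :: "nat \<Rightarrow> complex mat \<Rightarrow> bool" where
  "unitary_mat n U \<longleftrightarrow> U \<in> carrier_mat n n \<and>
     mat_adjoint U * U = 1\<^sub>m n \<and> U * mat_adjoint U = 1\<^sub>m n"

definition psd_mat :: "nat \<Rightarrow> complex mat \<Rightarrow> bool" where
  "psd_mat n M \<longleftrightarrow> M \<in> carrier_mat n n \<and> mat_adjoint M = M \<and>
     (\<forall>v \<in> carrier_vec n. 0 \<le> Re ((M *\<^sub>v v) \<bullet>c v))"

definition mat_fun :: "nat \<Rightarrow> (real \<Rightarrow> real) \<Rightarrow> complex mat \<Rightarrow> complex mat" where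
  "mat_fun n f M = (THE F. \<exists>U d. unitary_mat n U \<and>
     M = U * mat_diag n (\<lambda>i. complex_of_real (d i)) * mat_adjoint U \<and>
     F = U * mat_diag n (\<lambda>i. complex_of_real (f (d i))) * mat_adjoint U)"

definition operator_monotone :: "(real \<Rightarrow> real) \<Rightarrow> bool" where
  "operator_monotone f \<longleftrightarrow>
     (\<forall>n X Y. psd_mat n X \<and> invertible_mat X \<and> psd_mat n Y \<and> invertible_mat Y \<and>
        psd_mat n (Y - X) \<longrightarrow> psd_mat n (mat_fun n f Y - mat_fun n f X))"

definition op_decreases_to :: "(nat \<Rightarrow> 'a::complex_hilbert op) \<Rightarrow> 'a op \<Rightarrow> bool" where
  "op_decreases_to S T \<longleftrightarrow>
     (\<forall>n. positive_op (S n)) \<and> (\<forall>n. S (Suc n) \<sqsubseteq> S n) \<and>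
     (\<forall>x. (\<lambda>n. blinfun_apply (S n) x) \<longlonglongrightarrow> blinfun_apply T x)"

definition mean_continuous :: "('a::complex_hilbert op \<Rightarrow> 'a op \<Rightarrow> 'a op) \<Rightarrow> bool" where
  "mean_continuous \<sigma> \<longleftrightarrow>
     (\<forall>A B As Bs. positive_op A \<and> positive_op B \<and>
        op_decreases_to As A \<and> op_decreases_to Bs B \<longrightarrow>
        op_decreases_to (\<lambda>n. \<sigma> (As n) (Bs n)) (\<sigma> A B))"

text \<open>A binary operation on positive operators is modelled by a function on all operators whose
  values at other arguments are left unconstrained.\<close>

definition kubo_ando_axioms :: "('a::complex_hilbert op \<Rightarrow> 'a op \<Rightarrow> 'a op) \<Rightarrow> bool" where
  "kubo_ando_axioms \<sigma> \<longleftrightarrow>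
     (\<forall>A B. positive_op A \<and> positive_op B \<longrightarrow> positive_op (\<sigma> A B)) \<and>
     (\<forall>A B C D. positive_op A \<and> positive_op B \<and> positive_op C \<and> positive_op D \<and>
        A \<sqsubseteq> C \<and> B \<sqsubseteq> D \<longrightarrow> \<sigma> A B \<sqsubseteq> \<sigma> C D) \<and>
     (\<forall>A B C. positive_op A \<and> positive_op B \<and> positive_op C \<longrightarrow>
        C o\<^sub>L \<sigma> A B o\<^sub>L C \<sqsubseteq> \<sigma> (C o\<^sub>L A o\<^sub>L C) (C o\<^sub>L B o\<^sub>L C)) \<and>
     mean_continuous \<sigma> \<and>
     \<sigma> id_blinfun id_blinfun = id_blinfun"

text \<open>The formula determines the operation on invertible operators; continuity along decreasing
  sequences then determines it on all positive operators.\<close>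

definition kubo_ando_formula :: "('a::complex_hilbert op \<Rightarrow> 'a op \<Rightarrow> 'a op) \<Rightarrow> bool" where
  "kubo_ando_formula \<sigma> \<longleftrightarrow>
     (\<exists>f. operator_monotone f \<and> (\<forall>x>0. 0 \<le> f x) \<and> f 1 = 1 \<and>
        (\<forall>A B. positive_op A \<and> op_invertible A \<and> positive_op B \<and> op_invertible B \<longrightarrow>
           \<sigma> A B = op_powr A (1/2) o\<^sub>L
             cfc f (op_powr A (-1/2) o\<^sub>L B o\<^sub>L op_powr A (-1/2)) o\<^sub>L op_powr A (1/2))) \<and>
     mean_continuous \<sigma>"

text \<open>In finite dimension the axioms are too weak: already in dimension one they admit the minimum,
  which comes from \<open>x \<mapsto> min x 1\<close>, not operator monotone. There the formula, with \<open>f\<close> monotone on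
  matrices of all orders, is taken as the definition.\<close>

definition kubo_ando_mean :: "('a::complex_hilbert op \<Rightarrow> 'a op \<Rightarrow> 'a op) \<Rightarrow> bool" where
  "kubo_ando_mean \<sigma> \<longleftrightarrow>
     (if finite_dim TYPE('a) then kubo_ando_formula \<sigma> else kubo_ando_axioms \<sigma>)"

end

theory Submission
  imports Defs "HOL-Computational_Algebra.Fundamental_Theorem_Algebra"
begin

text \<open>With \<open>G = A\<^bsup>-1/2\<^esup>\<close>, \<open>X = G B G\<close> and \<open>Y = G (A \<sigma> B) G\<close> the claim is
  \<open>\<parallel>log Y\<parallel>\<^sub>2 \<le> \<parallel>log X\<parallel>\<^sub>2\<close>. It needs only two facts about \<open>Y\<close>: it commutes with \<open>X\<close>, and
  \<open>min 1 X \<le> Y \<le> max 1 X\<close>. Indeed \<open>log\<close> is monotone, so \<open>log Y\<close> lies between the negative and the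
  positive part of \<open>log X\<close>, which for commuting operators gives \<open>(log Y)\<^sup>2 \<le> (log X)\<^sup>2\<close>, and the
  traces compare term by term in any orthonormal basis.

  If \<open>\<sigma>\<close> is given by an operator monotone \<open>f\<close>, then \<open>Y = f(X)\<close>, and \<open>2 \<times> 2\<close> matrices show that \<open>f\<close> is
  nondecreasing and \<open>f(x)/x\<close> nonincreasing. If \<open>\<sigma>\<close> is given by the axioms, then \<open>Y = I \<sigma> X\<close>, and the
  Kubo-Ando integral representation is not needed: both bounds follow from the transformer inequality
  with functions of \<open>X\<close>, and so does \<open>C Y C \<le> Y\<close> for every \<open>C = c(X)\<close> with \<open>0 \<le> c \<le> 1\<close>, which forces
  \<open>Y\<close> to commute with \<open>X\<close>.\<close>

section \<open>Operators on a complex Hilbert space\<close>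

text \<open>The obstacle is commutation in the axiomatic case. For \<open>X\<close> diagonal with
  eigenvalues \<open>x_i\<close>, the first-order part in \<open>\<epsilon>\<close> of
  \<open>C Y C \<le> Y\<close> with \<open>C = 1 - \<epsilon> (X - t)\<^sup>2\<close> says that the
  matrix with entries \<open>((x_i - t)\<^sup>2 + (x_j - t)\<^sup>2) Y_ij\<close> is positive
  semidefinite. At \<open>t = x_i\<close> its i-th diagonal entry vanishes, hence so does its i-th
  row, and \<open>Y_ij = 0\<close> unless \<open>x_i = x_j\<close>. With continuous spectrum there
  are no eigenvectors to test on; estimates on small spectral pieces take their place. Commutation
  matters because squaring does not preserve the operator order: already
  \<open>0 \<le> K \<le> P\<close> fails to give \<open>K\<^sup>2 \<le> P\<^sup>2\<close> in
  general. The functional calculus rests on a single estimate: the norm of \<open>p(T)\<close> is at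
  most the supremum of \<open>|p|\<close> on the real spectrum of \<open>T\<close>, for real
  polynomials \<open>p\<close>.\<close>

instance complex_hilbert \<subseteq> banach ..

lemma inner_scaleC_left: "inner (c *\<^sub>C x) y = inner x (cnj c *\<^sub>C (y::'a::complex_inner))"
proof -
  have "cinner (c *\<^sub>C x) y = cinner x (cnj c *\<^sub>C y)"
    by (metis cinner_commute cinner_scaleC_right complex_cnj_mult)
  then show ?thesis by (metis Re_cinner)
qed

lemma Im_cinner: "Im (cinner x y) = inner x (- \<i> *\<^sub>C (y::'a::complex_inner))"
  by (simp flip: Re_cinner add: cinner_scaleC_right)

lemma scaleC_scaleR: "c *\<^sub>C r *\<^sub>R x = r *\<^sub>R c *\<^sub>C (x::'a::complex_inner)"
  by (simp flip: scaleC_of_real add: scaleC_scaleC mult.commute)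

text \<open>The imaginary part of \<open>cinner x y\<close> is a real inner product with
  \<open>- \<i> *\<^sub>C y\<close>, and complex linearity carries that scalar through
  \<open>T\<close>. From here on the real inner product suffices.\<close>

lemma selfadjoint_iff:
  "selfadjoint T \<longleftrightarrow> clinear_op T \<and> (\<forall>x y. inner (T x) y = inner x (T y))"
proof -
  have "(\<forall>x y. cinner (T x) y = cinner x (T y)) \<longleftrightarrow> (\<forall>x y. inner (T x) y = inner x (T y))"
    if "clinear_op T"
  proof safe
    fix x y assume *: "\<forall>x y. inner (T x) y = inner x (T y)"
    show "cinner (T x) y = cinner x (T y)"
      using * that by (intro complex_eqI) (simp_all add: Re_cinner Im_cinner clinear_op_def)
  qed (metis Re_cinner)
  then show ?thesis unfolding selfadjoint_def by blast
qed

lemma selfadjoint_inner: "selfadjoint T \<Longrightarrow> inner (T x) y = inner x (T y)"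
  by (simp add: selfadjoint_iff)

lemma positive_op_iff: "positive_op T \<longleftrightarrow> selfadjoint T \<and> (\<forall>x. 0 \<le> inner x (T x))"
  by (simp add: positive_op_def Re_cinner)

lemma positive_op_selfadjoint: "positive_op T \<Longrightarrow> selfadjoint T"
  by (simp add: positive_op_iff)

lemma selfadjoint_clinear: "selfadjoint T \<Longrightarrow> clinear_op T"
  by (simp add: selfadjoint_iff)

lemma clinear_op_compose: "clinear_op S \<Longrightarrow> clinear_op T \<Longrightarrow> clinear_op (S o\<^sub>L T)"
  by (simp add: clinear_op_def)

lemma clinear_op_tendsto:
  assumes "\<And>n. clinear_op (S n)" "S \<longlonglongrightarrow> T"
  shows "clinear_op (T :: 'a::complex_hilbert op)"
  unfolding clinear_op_def
proof safe
  fix c and x :: 'a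
  have lim: "(\<lambda>n. inner (S n x) y) \<longlonglongrightarrow> inner (T x) y" for x y
    by (intro tendsto_intros assms)
  have "inner (T (c *\<^sub>C x)) y = inner (c *\<^sub>C T x) y" for y
    using LIMSEQ_unique[OF lim[of "c *\<^sub>C x" y]] lim[of x "cnj c *\<^sub>C y"] assms(1)
    by (simp add: clinear_op_def inner_scaleC_left)
  then show "T (c *\<^sub>C x) = c *\<^sub>C T x"
    by (metis inner_commute vector_eq_ldot)
qed

lemma selfadjoint_tendsto:
  assumes "\<And>n. selfadjoint (S n)" "S \<longlonglongrightarrow> T"
  shows "selfadjoint (T :: 'a::complex_hilbert op)"
  unfolding selfadjoint_iff
proof safe
  show "clinear_op T" by (rule clinear_op_tendsto[OF selfadjoint_clinear[OF assms(1)] assms(2)])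
  fix x y :: 'a
  have "(\<lambda>n. inner (S n x) y) \<longlonglongrightarrow> inner (T x) y"
    by (intro tendsto_intros assms)
  moreover have "(\<lambda>n. inner x (S n y)) \<longlonglongrightarrow> inner x (T y)"
    by (intro tendsto_intros assms)
  ultimately show "inner (T x) y = inner x (T y)"
    by (simp only: selfadjoint_inner[OF assms(1)]) (rule LIMSEQ_unique)
qed

lemma positive_op_tendsto:
  assumes "\<And>n. positive_op (S n)" "S \<longlonglongrightarrow> T"
  shows "positive_op (T :: 'a::complex_hilbert op)"
  unfolding positive_op_iff
proof safe
  show "selfadjoint T" by (rule selfadjoint_tendsto[OF positive_op_selfadjoint[OF assms(1)] assms(2)])
  fix x :: 'a
  have "(\<lambda>n. inner x (S n x)) \<longlonglongrightarrow> inner x (T x)"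
    by (intro tendsto_intros assms)
  then show "0 \<le> inner x (T x)"
    by (rule LIMSEQ_le_const) (use assms(1) in \<open>simp add: positive_op_iff\<close>)
qed

lemma clinear_op_add: "clinear_op S \<Longrightarrow> clinear_op T \<Longrightarrow> clinear_op (S + T)"
  by (simp add: clinear_op_def blinfun.bilinear_simps scaleC_add_right)

lemma clinear_op_scaleR: "clinear_op T \<Longrightarrow> clinear_op (r *\<^sub>R T)"
  by (simp add: clinear_op_def blinfun.bilinear_simps scaleC_scaleR)

lemma selfadjoint_add: "selfadjoint S \<Longrightarrow> selfadjoint T \<Longrightarrow> selfadjoint (S + T)"
  by (simp add: selfadjoint_iff clinear_op_add blinfun.bilinear_simps inner_add_left inner_add_right)

lemma selfadjoint_scaleR: "selfadjoint T \<Longrightarrow> selfadjoint (r *\<^sub>R T)"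
  by (simp add: selfadjoint_iff clinear_op_scaleR blinfun.bilinear_simps)

lemma selfadjoint_diff: "selfadjoint S \<Longrightarrow> selfadjoint T \<Longrightarrow> selfadjoint (S - T)"
  using selfadjoint_add[of S "(-1) *\<^sub>R T"] selfadjoint_scaleR[of T "-1"] by simp

lemma selfadjoint_id: "selfadjoint id_blinfun"
  by (simp add: selfadjoint_iff clinear_op_def)

lemma selfadjoint_zero: "selfadjoint 0"
  using selfadjoint_scaleR[OF selfadjoint_id, of 0] by simp

lemma op_commute_apply: "S o\<^sub>L T = T o\<^sub>L S \<Longrightarrow> S (T x) = T (S x)"
  by (metis blinfun_apply_blinfun_compose)

lemma selfadjoint_compose:
  "selfadjoint S \<Longrightarrow> selfadjoint T \<Longrightarrow> S o\<^sub>L T = T o\<^sub>L S \<Longrightarrow> selfadjoint (S o\<^sub>L T)"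
  by (simp add: selfadjoint_iff clinear_op_compose) (metis op_commute_apply)

lemma selfadjoint_conj: "selfadjoint S \<Longrightarrow> selfadjoint T \<Longrightarrow> selfadjoint (S o\<^sub>L T o\<^sub>L S)"
  by (simp add: selfadjoint_iff clinear_op_compose)

lemma positive_op_add: "positive_op S \<Longrightarrow> positive_op T \<Longrightarrow> positive_op (S + T)"
  by (simp add: positive_op_iff selfadjoint_add blinfun.bilinear_simps inner_add_right)

lemma positive_op_scaleR: "positive_op T \<Longrightarrow> 0 \<le> r \<Longrightarrow> positive_op (r *\<^sub>R T)"
  by (simp add: positive_op_iff selfadjoint_scaleR blinfun.bilinear_simps)

lemma positive_op_id: "positive_op id_blinfun"
  by (simp add: positive_op_iff selfadjoint_id)

lemma positive_op_conj: "selfadjoint S \<Longrightarrow> positive_op T \<Longrightarrow> positive_op (S o\<^sub>L T o\<^sub>L S)"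
  unfolding positive_op_iff by (simp add: selfadjoint_conj flip: selfadjoint_inner[of S])

lemma positive_op_square: "selfadjoint S \<Longrightarrow> positive_op (S o\<^sub>L S)"
  unfolding positive_op_iff
  by (metis blinfun_apply_blinfun_compose inner_ge_zero selfadjoint_compose selfadjoint_inner)

lemma op_le_inner: "S \<sqsubseteq> T \<Longrightarrow> inner x (S x) \<le> inner x (T x)"
  by (simp add: op_le_def positive_op_iff blinfun.bilinear_simps inner_diff_right)

lemma op_le_trans [trans]: "R \<sqsubseteq> S \<Longrightarrow> S \<sqsubseteq> T \<Longrightarrow> R \<sqsubseteq> T"
  unfolding op_le_def using positive_op_add by fastforce

lemma op_compose_assoc: "R o\<^sub>L S o\<^sub>L T = R o\<^sub>L (S o\<^sub>L T)"
  by (rule blinfun_eqI) simp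

lemmas op_distribs =
  bounded_bilinear.add_left[OF bounded_bilinear_blinfun_compose]
  bounded_bilinear.add_right[OF bounded_bilinear_blinfun_compose]
  bounded_bilinear.diff_left[OF bounded_bilinear_blinfun_compose]
  bounded_bilinear.diff_right[OF bounded_bilinear_blinfun_compose]
  bounded_bilinear.scaleR_left[OF bounded_bilinear_blinfun_compose]
  bounded_bilinear.scaleR_right[OF bounded_bilinear_blinfun_compose]

lemma id_compose [simp]: "id_blinfun o\<^sub>L T = T" "T o\<^sub>L id_blinfun = T"
  by (auto intro: blinfun_eqI)

lemma op_le_conj: "S \<sqsubseteq> T \<Longrightarrow> selfadjoint C \<Longrightarrow> C o\<^sub>L S o\<^sub>L C \<sqsubseteq> C o\<^sub>L T o\<^sub>L C"
  unfolding op_le_def using positive_op_conj[of C "T - S"] by (simp add: op_distribs)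

text \<open>Polarisation: a self-adjoint operator whose quadratic form vanishes is zero.\<close>

lemma op_le_antisym: "S \<sqsubseteq> T \<Longrightarrow> T \<sqsubseteq> S \<Longrightarrow> S = T"
proof -
  assume "S \<sqsubseteq> T" "T \<sqsubseteq> S"
  then have sa: "selfadjoint (T - S)" and 0: "inner x ((T - S) x) = 0" for x
    using op_le_inner[of S T x] op_le_inner[of T S x]
    by (auto simp: op_le_def positive_op_iff blinfun.bilinear_simps inner_diff_right intro: antisym)
  have "inner y ((T - S) x) = 0" for x y
    using 0[of "x + y"] 0[of x] 0[of y] selfadjoint_inner[OF sa, of x y]
    by (simp only: blinfun.bilinear_simps inner_add_left inner_add_right)
      (simp add: inner_commute algebra_simps)
  then have "(T - S) x = 0" for x
    by (metis inner_eq_zero_iff)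
  then show "S = T"
    by (intro blinfun_eqI) (simp add: blinfun.bilinear_simps)
qed

section \<open>Invertibility and lower bounds\<close>

lemma op_invertible_compose: "op_invertible S \<Longrightarrow> op_invertible T \<Longrightarrow> op_invertible (S o\<^sub>L T)"
  unfolding op_invertible_def
proof (elim exE conjE)
  fix U V assume *: "U o\<^sub>L S = id_blinfun" "S o\<^sub>L U = id_blinfun" "V o\<^sub>L T = id_blinfun" "T o\<^sub>L V = id_blinfun"
  have "(V o\<^sub>L U) o\<^sub>L (S o\<^sub>L T) = V o\<^sub>L (U o\<^sub>L S) o\<^sub>L T"
    "(S o\<^sub>L T) o\<^sub>L (V o\<^sub>L U) = S o\<^sub>L (T o\<^sub>L V) o\<^sub>L U"
    by (simp_all only: op_compose_assoc)
  then show "\<exists>W. W o\<^sub>L (S o\<^sub>L T) = id_blinfun \<and> S o\<^sub>L T o\<^sub>L W = id_blinfun"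
    using * by auto
qed

lemma op_invertible_bounded_below:
  assumes "op_invertible T"
  obtains c where "c > 0" "\<And>x. c * norm x \<le> norm (T x)"
proof -
  obtain S where S: "S o\<^sub>L T = id_blinfun" using assms by (auto simp: op_invertible_def)
  \<comment> \<open>The summand 1 keeps the reciprocal well defined when \<open>norm S = 0\<close>,
    as in the zero space.\<close>
  have "norm x \<le> (norm S + 1) * norm (T x)" for x
  proof -
    have "norm x = norm (S (T x))"
      by (metis S blinfun_apply_blinfun_compose blinfun_apply_id_blinfun)
    also have "\<dots> \<le> norm S * norm (T x)" by (rule norm_blinfun)
    also have "\<dots> \<le> (norm S + 1) * norm (T x)" by (simp add: mult_right_mono)
    finally show ?thesis .
  qed
  then show thesis
    using add_pos_nonneg[of 1 "norm S"]
    by (intro that[of "1 / (norm S + 1)"]) (simp_all add: field_simps)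
qed

text \<open>For \<open>M \<ge> \<parallel>T\<parallel>\<close> the map \<open>x \<mapsto> x - (T\<^sup>2 x - y) / M\<^sup>2\<close> is a contraction, so \<open>T\<^sup>2\<close> is onto.\<close>

lemma selfadjoint_bounded_below_invertible:
  fixes T :: "'a::complex_hilbert op"
  assumes sa: "selfadjoint T" and c: "c > 0" "\<And>x. c * norm x \<le> norm (T x)"
  shows "op_invertible T"
proof -
  define M where "M = norm T + 1"
  have M: "M > 0" "\<And>x. norm (T x) \<le> M * norm x"
  proof -
    show "norm (T x) \<le> M * norm x" for x
      using norm_blinfun[of T x] mult_right_mono[of "norm T" M "norm x"] unfolding M_def by simp
  qed (simp add: M_def add_nonneg_pos)
  define t where "t = 1 / M\<^sup>2"
  have t: "t > 0" "t * M\<^sup>2 = 1" using M by (auto simp: t_def)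
  \<comment> \<open>In the zero space \<open>c\<close> may be any positive number, so
    \<open>1 - t * c\<^sup>2\<close> can be negative there; the truncation covers this.\<close>
  define q where "q = sqrt (max 0 (1 - t * c\<^sup>2))"
  have q: "0 \<le> q" "q < 1" "max 0 (1 - t * c\<^sup>2) = q\<^sup>2"
    using t c by (auto simp: q_def real_sqrt_less_iff)
  have contr: "norm (x - t *\<^sub>R T (T x)) \<le> q * norm x" for x
  proof -
    have a: "(norm (T (T x)))\<^sup>2 \<le> M\<^sup>2 * (norm (T x))\<^sup>2"
      using M(2)[of "T x"] by (metis norm_ge_zero power_mono power_mult_distrib)
    have "(norm (x - t *\<^sub>R T (T x)))\<^sup>2
        = (norm x)\<^sup>2 - 2 * t * (norm (T x))\<^sup>2 + t * t * (norm (T (T x)))\<^sup>2"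
      using selfadjoint_inner[OF sa, of x "T x"]
      by (simp add: power2_norm_eq_inner inner_diff_left inner_diff_right inner_commute
          algebra_simps)
    also have "t * t * (norm (T (T x)))\<^sup>2 \<le> t * t * (M\<^sup>2 * (norm (T x))\<^sup>2)"
      by (intro mult_left_mono a) simp
    also have "\<dots> = t * (t * M\<^sup>2) * (norm (T x))\<^sup>2" by (simp add: power2_eq_square)
    also have "\<dots> = t * (norm (T x))\<^sup>2" by (simp add: t(2))
    finally have "(norm (x - t *\<^sub>R T (T x)))\<^sup>2 \<le> (norm x)\<^sup>2 - t * (norm (T x))\<^sup>2" by simp
    also have "(c * norm x)\<^sup>2 \<le> (norm (T x))\<^sup>2"
      using c by (intro power_mono) auto
    then have "(norm x)\<^sup>2 - t * (norm (T x))\<^sup>2 \<le> (1 - t * c\<^sup>2) * (norm x)\<^sup>2"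
      using t(1) by (simp add: algebra_simps)
    also have "\<dots> \<le> (q * norm x)\<^sup>2"
      unfolding power_mult_distrib q(3)[symmetric] by (intro mult_right_mono) auto
    finally show ?thesis
      by (rule power2_le_imp_le) (use q(1) in simp)
  qed
  have surj: "\<exists>x. T x = y" for y
  proof -
    have "\<exists>!x. x - t *\<^sub>R (T (T x) - y) = x"
    proof (rule banach_fix_type[OF q(1,2)], safe)
      fix u v
      have "u - t *\<^sub>R (T (T u) - y) - (v - t *\<^sub>R (T (T v) - y)) = (u - v) - t *\<^sub>R T (T (u - v))"
        by (simp add: blinfun.bilinear_simps algebra_simps)
      then show "dist (u - t *\<^sub>R (T (T u) - y)) (v - t *\<^sub>R (T (T v) - y)) \<le> q * dist u v"
        unfolding dist_norm using contr[of "u - v"] by (simp only:)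
    qed
    then obtain x where "x - t *\<^sub>R (T (T x) - y) = x" by blast
    then have "T (T x) = y" using t by simp
    then show ?thesis by blast
  qed
  have inj: "u = v" if "T u = T v" for u v
    using c(2)[of "u - v"] that c(1) by (simp add: blinfun.bilinear_simps mult_le_0_iff)
  define S where "S y = (THE x. T x = y)" for y
  have TS: "T (S y) = y" for y
    unfolding S_def by (rule theI') (use surj inj in blast)
  have ST: "S (T x) = x" for x
    by (rule inj) (simp add: TS)
  have "bounded_linear S"
  proof (rule bounded_linear_intro)
    show "S (x + y) = S x + S y" for x y by (rule inj) (simp add: blinfun.bilinear_simps TS)
    show "S (r *\<^sub>R x) = r *\<^sub>R S x" for r x by (rule inj) (simp add: blinfun.bilinear_simps TS)
    show "norm (S x) \<le> norm x * (1 / c)" for x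
      using c(2)[of "S x"] c(1) by (simp add: TS field_simps)
  qed
  then have "Blinfun S o\<^sub>L T = id_blinfun" "T o\<^sub>L Blinfun S = id_blinfun"
    by (auto intro!: blinfun_eqI simp: bounded_linear_Blinfun_apply TS ST)
  then show ?thesis unfolding op_invertible_def by blast
qed

section \<open>Real polynomials of an operator\<close>

lemma poly_op_altdef:
  "degree p \<le> n \<Longrightarrow> poly_op p T = (\<Sum>i\<le>n. coeff p i *\<^sub>R (((o\<^sub>L) T ^^ i) id_blinfun))"
  unfolding poly_op_def by (rule sum.mono_neutral_left) (auto simp: coeff_eq_0)

lemma poly_op_0 [simp]: "poly_op 0 T = 0"
  by (simp add: poly_op_def)

text \<open>Horner's scheme: it turns the algebraic laws of \<open>poly_op\<close> into inductions
  over \<open>pCons\<close>.\<close>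

lemma poly_op_pCons: "poly_op (pCons a p) T = a *\<^sub>R id_blinfun + (T o\<^sub>L poly_op p T)"
proof -
  have "poly_op (pCons a p) T
      = (\<Sum>i\<le>Suc (degree p). coeff (pCons a p) i *\<^sub>R (((o\<^sub>L) T ^^ i) id_blinfun))"
    by (rule poly_op_altdef) (simp add: degree_pCons_le)
  also have "\<dots> = a *\<^sub>R id_blinfun + (T o\<^sub>L poly_op p T)"
    unfolding sum.atMost_Suc_shift poly_op_def
    by (simp add: bounded_bilinear.sum_right[OF bounded_bilinear_blinfun_compose] op_distribs)
  finally show ?thesis .
qed

lemma poly_op_add: "poly_op (p + q) T = poly_op p T + poly_op q T"
  by (induction p q rule: poly_induct2) (simp_all add: poly_op_pCons op_distribs scaleR_add_left)

lemma poly_op_smult: "poly_op (Polynomial.smult a p) T = a *\<^sub>R poly_op p T"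
  by (induction p) (simp_all add: poly_op_pCons op_distribs scaleR_add_right)

lemma poly_op_diff: "poly_op (p - q) T = poly_op p T - poly_op q T"
  using poly_op_add[of "p - q" q T] by simp

lemma poly_op_mult: "poly_op (p * q) T = poly_op p T o\<^sub>L poly_op q T"
  by (induction p)
    (simp_all add: poly_op_pCons poly_op_add poly_op_smult op_distribs op_compose_assoc)

lemma poly_op_commute: "S o\<^sub>L T = T o\<^sub>L S \<Longrightarrow> S o\<^sub>L poly_op p T = poly_op p T o\<^sub>L S"
proof (induction p)
  case (pCons a p)
  have "S o\<^sub>L (T o\<^sub>L poly_op p T) = T o\<^sub>L (S o\<^sub>L poly_op p T)"
    by (metis op_compose_assoc pCons.prems)
  then show ?case using pCons by (simp add: poly_op_pCons op_distribs op_compose_assoc)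
qed simp

lemma selfadjoint_poly_op: "selfadjoint T \<Longrightarrow> selfadjoint (poly_op p T)"
  by (induction p)
    (auto simp: poly_op_pCons selfadjoint_zero
      intro!: selfadjoint_add selfadjoint_scaleR selfadjoint_id selfadjoint_compose poly_op_commute)

section \<open>Spectrum of a self-adjoint operator\<close>

lemma in_op_spectrum_iff: "r \<in> op_spectrum T \<longleftrightarrow> \<not> op_invertible (T - r *\<^sub>R id_blinfun)"
  by (simp add: op_spectrum_def)

lemma selfadjoint_shift: "selfadjoint T \<Longrightarrow> selfadjoint (T - r *\<^sub>R id_blinfun)"
  by (intro selfadjoint_diff selfadjoint_scaleR selfadjoint_id)

text \<open>With \<open>n = norm S\<close>, if both points were missing,
  \<open>S\<^sup>2 - n\<^sup>2\<close> would be bounded below by some \<open>c > 0\<close>.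
  Expanding the square of its norm at \<open>x\<close> and using
  \<open>norm (S (S x)) \<le> n * norm (S x)\<close> gives \<open>(norm (S x))\<^sup>2 \<le>
  (n\<^sup>2 - c\<^sup>2 / n\<^sup>2) * (norm x)\<^sup>2\<close>, which contradicts the definition
  of \<open>n\<close>.\<close>

lemma norm_or_minus_norm_in_spectrum:
  fixes S :: "'a::complex_hilbert op"
  assumes sa: "selfadjoint S" and "S \<noteq> 0"
  shows "norm S \<in> op_spectrum S \<or> - norm S \<in> op_spectrum S"
proof (rule ccontr)
  define n where "n = norm S"
  have n: "n > 0" using \<open>S \<noteq> 0\<close> by (simp add: n_def)
  assume "\<not> ?thesis"
  then have "op_invertible ((S - (-n) *\<^sub>R id_blinfun) o\<^sub>L (S - n *\<^sub>R id_blinfun))"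
    by (intro op_invertible_compose) (simp_all add: in_op_spectrum_iff n_def)
  then obtain c where c: "c > 0"
    "\<And>x. c * norm x \<le> norm (((S - (-n) *\<^sub>R id_blinfun) o\<^sub>L (S - n *\<^sub>R id_blinfun)) x)"
    by (rule op_invertible_bounded_below) blast
  define d where "d = c\<^sup>2 / n\<^sup>2"
  have d: "d > 0" using n c by (simp add: d_def)
  have key: "(norm (S x))\<^sup>2 \<le> (n\<^sup>2 - d) * (norm x)\<^sup>2" for x
  proof -
    have "((S - (-n) *\<^sub>R id_blinfun) o\<^sub>L (S - n *\<^sub>R id_blinfun)) x = S (S x) - (n * n) *\<^sub>R x"
      by (simp add: blinfun.bilinear_simps scaleR_diff_right scaleR_add_right)
    then have "(c * norm x)\<^sup>2 \<le> (norm (S (S x) - (n * n) *\<^sub>R x))\<^sup>2"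
      using c(2)[of x] c(1) by (intro power_mono) auto
    also have "\<dots> = (norm (S (S x)))\<^sup>2 - 2 * (n * n) * (norm (S x))\<^sup>2 + (n * n) * (n * n) * (norm x)\<^sup>2"
      using selfadjoint_inner[OF sa, of x "S x"]
      by (simp add: power2_norm_eq_inner inner_diff_left inner_diff_right inner_commute
          algebra_simps)
    also have "(norm (S (S x)))\<^sup>2 \<le> (n * norm (S x))\<^sup>2"
      using norm_blinfun[of S "S x"] by (intro power_mono) (simp_all add: n_def)
    finally have "c\<^sup>2 * (norm x)\<^sup>2 \<le> n\<^sup>2 * (n\<^sup>2 * (norm x)\<^sup>2 - (norm (S x))\<^sup>2)"
      by (simp add: power_mult_distrib power2_eq_square algebra_simps)
    then show ?thesis using n by (simp add: d_def field_simps)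
  qed
  have "n\<^sup>2 - d \<ge> 0"
  proof (rule ccontr)
    assume "\<not> n\<^sup>2 - d \<ge> 0"
    have "S x = 0" for x
    proof (cases "x = 0")
      case False
      then have "(n\<^sup>2 - d) * (norm x)\<^sup>2 < 0"
        using \<open>\<not> n\<^sup>2 - d \<ge> 0\<close> by (intro mult_neg_pos) auto
      then show ?thesis using key[of x] zero_le_power2[of "norm (S x)"] by linarith
    qed (simp add: blinfun.bilinear_simps)
    then have "S = 0" by (intro blinfun_eqI) simp
    then show False using \<open>S \<noteq> 0\<close> by simp
  qed
  have "norm (S x) \<le> sqrt (n\<^sup>2 - d) * norm x" for x
    using real_sqrt_le_mono[OF key[of x]] by (simp add: real_sqrt_mult)
  then have "n \<le> sqrt (n\<^sup>2 - d)"
    unfolding n_def by (intro norm_blinfun_bound) (use \<open>n\<^sup>2 - d \<ge> 0\<close> in \<open>simp_all add: n_def\<close>)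
  then have "n\<^sup>2 \<le> n\<^sup>2 - d"
    using n \<open>n\<^sup>2 - d \<ge> 0\<close> by (metis less_imp_le power_mono real_sqrt_pow2)
  then show False using d by simp
qed

text \<open>The operator \<open>S\<close> is there to exclude the zero space, where every operator
  is invertible and all spectra are empty.\<close>

lemma op_spectrum_nonempty:
  fixes T :: "'a::complex_hilbert op"
  assumes "selfadjoint T" "\<not> op_invertible (S :: 'a op)"
  shows "op_spectrum T \<noteq> {}"
proof (cases "T = 0")
  case True
  have "x = 0" if "U o\<^sub>L (0 :: 'a op) = id_blinfun" for x :: 'a and U :: "'a op"
    using that by (metis blinfun_apply_id_blinfun blinfun_compose_zero(2) zero_blinfun.rep_eq)
  moreover have False if "\<And>x::'a. x = 0"
  proof -
    have "S o\<^sub>L S = id_blinfun" by (rule blinfun_eqI) (metis that)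
    then show False using assms(2) by (auto simp: op_invertible_def)
  qed
  ultimately have "0 \<in> op_spectrum T"
    unfolding in_op_spectrum_iff True op_invertible_def by auto
  then show ?thesis by auto
qed (use norm_or_minus_norm_in_spectrum assms(1) in blast)

text \<open>This and the next four lemmas make evaluation of real polynomials at a complex point a
  ring homomorphism, so that complex roots can be used to factor over the reals.\<close>

lemma poly_complex_of_real_pCons:
  "poly (map_poly complex_of_real (pCons a p)) z = of_real a + z * poly (map_poly of_real p) z"
  by (subst Polynomial.map_poly_pCons) simp_all

lemma poly_complex_of_real_add:
  "poly (map_poly complex_of_real (p + q)) z
     = poly (map_poly of_real p) z + poly (map_poly of_real q) z"
  by (induction p q rule: poly_induct2) (simp_all add: poly_complex_of_real_pCons algebra_simps)

lemma poly_complex_of_real_smult: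
  "poly (map_poly complex_of_real (Polynomial.smult a p)) z = of_real a * poly (map_poly of_real p) z"
  by (induction p) (simp_all add: poly_complex_of_real_pCons algebra_simps)

lemma poly_complex_of_real_mult:
  "poly (map_poly complex_of_real (p * q)) z
     = poly (map_poly of_real p) z * poly (map_poly of_real q) z"
  by (induction p)
    (simp_all add: poly_complex_of_real_pCons poly_complex_of_real_add poly_complex_of_real_smult algebra_simps)

lemma poly_complex_of_real_of_real:
  "poly (map_poly complex_of_real p) (of_real x) = of_real (poly p x)"
  by (induction p) (simp_all add: poly_complex_of_real_pCons)

text \<open>A pair of conjugate non-real roots contributes an invertible factor \<open>(T - a)\<^sup>2 + b\<^sup>2\<close>.\<close>

lemma noninvertible_poly_op_root:
  fixes T :: "'a::complex_hilbert op"
  assumes sa: "selfadjoint T" and "q \<noteq> 0" "\<not> op_invertible (poly_op q T)"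
  shows "\<exists>l\<in>op_spectrum T. poly q l = 0"
  using assms(2,3)
proof (induction "degree q" arbitrary: q rule: less_induct)
  case less
  let ?q = "map_poly complex_of_real q"
  have "degree q \<noteq> 0"
  proof
    assume "degree q = 0"
    then obtain c where c: "q = [:c:]" by (rule degree_eq_zeroE)
    have "op_invertible (c *\<^sub>R (id_blinfun :: 'a op))" if "c \<noteq> 0"
      unfolding op_invertible_def using that
      by (intro exI[of _ "(1/c) *\<^sub>R id_blinfun"]) (simp add: op_distribs)
    then show False using c less.prems by (auto simp: poly_op_pCons)
  qed
  then have "\<not> constant (poly ?q)"
    by (simp add: constant_degree degree_map_poly)
  then obtain z where z: "poly ?q z = 0"
    using fundamental_theorem_of_algebra by blast
  \<comment> \<open>Splitting off a factor \<open>w\<close>: if \<open>poly_op w T\<close> is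
    invertible, the cofactor inherits non-invertibility and has smaller degree; otherwise
    \<open>w\<close> itself supplies the root.\<close>
  have split: ?case if w: "q = w * q'" "degree w \<noteq> 0"
    and inv: "\<not> op_invertible (poly_op w T) \<Longrightarrow> \<exists>l\<in>op_spectrum T. poly w l = 0" for w q'
  proof (cases "op_invertible (poly_op w T)")
    case True
    have "w \<noteq> 0" "q' \<noteq> 0" using less.prems(1) w(1) by auto
    then have "degree q' < degree q" using w by (simp add: degree_mult_eq)
    moreover have "\<not> op_invertible (poly_op q' T)"
      using True less.prems(2) w(1) op_invertible_compose by (auto simp: poly_op_mult)
    ultimately show ?thesis using less.hyps[of q'] \<open>q' \<noteq> 0\<close> w(1) by auto
  next
    case False
    then show ?thesis using inv w(1) by auto
  qed
  show ?case
  proof (cases "Im z = 0")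
    case True
    then have "poly ?q (of_real (Re z)) = 0" using z by (simp add: complex_is_Real_iff)
    then have "of_real (poly q (Re z)) = (0::complex)" by (simp add: poly_complex_of_real_of_real)
    then have "poly q (Re z) = 0" by simp
    then obtain q' where q': "q = [:- Re z, 1:] * q'"
      by (metis dvdE poly_eq_0_iff_dvd)
    show ?thesis
    proof (rule split[OF q'])
      assume "\<not> op_invertible (poly_op [:- Re z, 1:] T)"
      then have "Re z \<in> op_spectrum T"
        by (simp add: in_op_spectrum_iff poly_op_pCons)
      then show "\<exists>l\<in>op_spectrum T. poly [:- Re z, 1:] l = 0" by (intro bexI) auto
    qed simp
  next
    case False
    \<comment> \<open>The real quadratic with roots \<open>z\<close> and \<open>cnj z\<close>. It
      divides \<open>q\<close>: the remainder is real of degree at most 1 and vanishes at the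
      non-real point \<open>z\<close>, hence is zero.\<close>
    define w where "w = [: (Re z)\<^sup>2 + (Im z)\<^sup>2, - 2 * Re z, 1:]"
    define r where "r = q mod w"
    have dw: "degree w = 2" by (simp add: w_def)
    have "w \<noteq> 0" by (simp add: w_def)
    then have "r = 0 \<or> degree r < 2" using degree_mod_less[of w q] dw by (simp add: r_def)
    then have dr: "degree r \<le> 1" by auto
    have zw: "poly (map_poly complex_of_real w) z = 0"
      by (simp add: w_def complex_eq_iff power2_eq_square algebra_simps poly_complex_of_real_pCons)
    have "?q = map_poly of_real (q div w * w + r)" by (simp add: r_def)
    then have "poly (map_poly complex_of_real r) z = 0"
      using z zw by (simp add: poly_complex_of_real_add poly_complex_of_real_mult)
    moreover obtain r0 r1 where r: "r = [:r0, r1:]"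
    proof -
      obtain r0 s where s: "r = pCons r0 s" by (cases r)
      then have "degree s = 0" using dr by (cases "s = 0") auto
      then obtain r1 where "s = [:r1:]" by (rule degree_eq_zeroE)
      then show thesis using that s by blast
    qed
    ultimately have "r1 = 0" "r0 = 0"
      using False by (auto simp: complex_eq_iff poly_complex_of_real_pCons)
    then have "r = 0" using r by simp
    then obtain q' where q': "q = w * q'" by (metis dvdE mod_eq_0_iff_dvd r_def)
    define V where "V = T - Re z *\<^sub>R id_blinfun"
    have V: "selfadjoint V" unfolding V_def by (rule selfadjoint_shift[OF sa])
    have W: "poly_op w T = (V o\<^sub>L V) + (Im z)\<^sup>2 *\<^sub>R id_blinfun"
      by (rule blinfun_eqI)
        (simp add: w_def V_def poly_op_pCons blinfun.bilinear_simps power2_eq_square algebra_simps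
          flip: scaleR_add_left)
    have "op_invertible (poly_op w T)"
    proof (rule selfadjoint_bounded_below_invertible)
      show "selfadjoint (poly_op w T)" by (rule selfadjoint_poly_op[OF sa])
      show "(Im z)\<^sup>2 > 0" using False by simp
      show "(Im z)\<^sup>2 * norm x \<le> norm (poly_op w T x)" for x
      proof (cases "x = 0")
        case False
        have "(Im z)\<^sup>2 * (norm x)\<^sup>2 \<le> inner x (poly_op w T x)"
          unfolding W using selfadjoint_inner[OF V, of x "V x"] inner_ge_zero[of "V x"]
          by (simp add: blinfun.bilinear_simps inner_add_right power2_norm_eq_inner)
        also have "\<dots> \<le> norm x * norm (poly_op w T x)" by (rule norm_cauchy_schwarz)
        finally have "norm x * ((Im z)\<^sup>2 * norm x) \<le> norm x * norm (poly_op w T x)"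
          by (simp add: power2_eq_square algebra_simps)
        then show ?thesis using False by simp
      qed simp
    qed
    then show ?thesis using split[OF q'] dw by simp
  qed
qed

lemma op_spectrum_poly_op:
  assumes "selfadjoint T" "r \<in> op_spectrum (poly_op p T)"
  shows "\<exists>l\<in>op_spectrum T. poly p l = r"
proof (cases "p = [:r:]")
  \<comment> \<open>Here \<open>p - [:r:]\<close> is zero and the root lemma does not apply. Any
    spectral point of \<open>T\<close> will do, and one exists because some operator is not
    invertible.\<close>
  case True
  then show ?thesis using op_spectrum_nonempty[OF assms(1)] assms(2)
    by (auto simp del: poly_op_pCons simp: in_op_spectrum_iff[of r])
next
  case False
  then have "\<exists>l\<in>op_spectrum T. poly (p - [:r:]) l = 0"
    using assms by (intro noninvertible_poly_op_root)
      (simp_all add: in_op_spectrum_iff poly_op_diff poly_op_pCons)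
  then show ?thesis by simp
qed

text \<open>The norm is, up to sign, a spectral point of \<open>poly_op p T\<close>, and that point
  is a value of \<open>p\<close> on the spectrum of \<open>T\<close>. Uniform convergence on the
  spectrum therefore implies norm convergence of operators.\<close>

lemma norm_poly_op_le:
  assumes "selfadjoint T" "0 \<le> c" "\<And>l. l \<in> op_spectrum T \<Longrightarrow> \<bar>poly p l\<bar> \<le> c"
  shows "norm (poly_op p T) \<le> c"
proof (cases "poly_op p T = 0")
  case False
  then obtain r where "r \<in> op_spectrum (poly_op p T)" "\<bar>r\<bar> = norm (poly_op p T)"
    using norm_or_minus_norm_in_spectrum[OF selfadjoint_poly_op[OF assms(1)]] by fastforce
  then show ?thesis using op_spectrum_poly_op[OF assms(1)] assms(3) by metis
qed (use assms in simp)

text \<open>For \<open>\<bar>r\<bar> > norm T\<close> the operator \<open>T - r\<close> is bounded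
  below, and a lower bound \<open>c\<close> at \<open>r\<close> leaves \<open>c / 2\<close> at every
  point closer than \<open>c / 2\<close>. Lower bounds imply invertibility for self-adjoint
  operators.\<close>

lemma compact_op_spectrum:
  assumes sa: "selfadjoint T"
  shows "compact (op_spectrum T)"
proof -
  have "\<bar>r\<bar> \<le> norm T" if "r \<in> op_spectrum T" for r
  proof (rule ccontr)
    assume *: "\<not> \<bar>r\<bar> \<le> norm T"
    have "op_invertible (T - r *\<^sub>R id_blinfun)"
    proof (rule selfadjoint_bounded_below_invertible[OF selfadjoint_shift[OF sa]])
      show "\<bar>r\<bar> - norm T > 0" using * by simp
      fix x
      have "\<bar>r\<bar> * norm x \<le> norm (T x) + norm (T x - r *\<^sub>R x)"
        using norm_triangle_ineq4[of "T x" "T x - r *\<^sub>R x"] by simp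
      then show "(\<bar>r\<bar> - norm T) * norm x \<le> norm ((T - r *\<^sub>R id_blinfun) x)"
        using norm_blinfun[of T x] by (simp add: blinfun.bilinear_simps algebra_simps)
    qed
    then show False using that by (simp add: in_op_spectrum_iff)
  qed
  then have "bounded (op_spectrum T)" by (auto simp: bounded_iff)
  moreover have "open (- op_spectrum T)"
    unfolding open_dist
  proof safe
    fix r assume "r \<notin> op_spectrum T"
    then have "op_invertible (T - r *\<^sub>R id_blinfun)" by (simp add: in_op_spectrum_iff)
    then obtain c where c: "c > 0" "\<And>x. c * norm x \<le> norm ((T - r *\<^sub>R id_blinfun) x)"
      by (rule op_invertible_bounded_below) blast
    have "s \<notin> op_spectrum T" if "dist s r < c / 2" for s
      unfolding in_op_spectrum_iff not_not
    proof (rule selfadjoint_bounded_below_invertible[OF selfadjoint_shift[OF sa]])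
      show "c / 2 > 0" using c by simp
      fix x
      have "(T - r *\<^sub>R id_blinfun) x = (T - s *\<^sub>R id_blinfun) x + (s - r) *\<^sub>R x"
        by (simp add: blinfun.bilinear_simps algebra_simps)
      then have "c * norm x \<le> norm ((T - s *\<^sub>R id_blinfun) x) + \<bar>s - r\<bar> * norm x"
        using c(2)[of x] norm_triangle_ineq[of "(T - s *\<^sub>R id_blinfun) x" "(s - r) *\<^sub>R x"] by simp
      moreover have "\<bar>s - r\<bar> * norm x \<le> c / 2 * norm x"
        using that by (intro mult_right_mono) (auto simp: dist_real_def)
      ultimately show "c / 2 * norm x \<le> norm ((T - s *\<^sub>R id_blinfun) x)" by simp
    qed
    then show "\<exists>e>0. \<forall>s. dist s r < e \<longrightarrow> s \<in> - op_spectrum T"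
      using c(1) by (intro exI[of _ "c / 2"]) auto
  qed
  ultimately show ?thesis by (simp add: compact_eq_bounded_closed closed_def)
qed

lemma op_spectrum_nonneg:
  assumes "positive_op T" "r \<in> op_spectrum T"
  shows "0 \<le> r"
proof (rule ccontr)
  assume "\<not> 0 \<le> r"
  have "op_invertible (T - r *\<^sub>R id_blinfun)"
  proof (rule selfadjoint_bounded_below_invertible[OF selfadjoint_shift])
    show "selfadjoint T" "- r > 0" using assms \<open>\<not> 0 \<le> r\<close> by (auto simp: positive_op_iff)
    show "- r * norm x \<le> norm ((T - r *\<^sub>R id_blinfun) x)" for x
    proof (cases "x = 0")
      case False
      have "- r * (norm x)\<^sup>2 \<le> inner x ((T - r *\<^sub>R id_blinfun) x)"
        using assms by (simp add: positive_op_iff blinfun.bilinear_simps inner_diff_right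
            power2_norm_eq_inner)
      also have "\<dots> \<le> norm x * norm ((T - r *\<^sub>R id_blinfun) x)" by (rule norm_cauchy_schwarz)
      finally have "norm x * (- r * norm x) \<le> norm x * norm ((T - r *\<^sub>R id_blinfun) x)"
        by (simp add: power2_eq_square algebra_simps)
      then show ?thesis by (rule mult_left_le_imp_le) (use False in simp)
    qed simp
  qed
  then show False using assms by (simp add: in_op_spectrum_iff)
qed

lemma op_spectrum_pos:
  assumes "positive_op T" "op_invertible T" "r \<in> op_spectrum T"
  shows "0 < r"
proof -
  have "r \<noteq> 0" using assms by (auto simp: in_op_spectrum_iff)
  then show ?thesis using op_spectrum_nonneg assms by force
qed

lemma uniform_limit_polys:
  fixes f :: "real \<Rightarrow> real"
  assumes "compact K" "continuous_on K f"
  obtains p :: "nat \<Rightarrow> real poly" where "uniform_limit K (\<lambda>n. poly (p n)) f sequentially"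
proof -
  have "\<exists>p. \<forall>x\<in>K. \<bar>f x - poly p x\<bar> < inverse (real (Suc n))" for n
  proof -
    obtain g where g: "real_polynomial_function g" "\<And>x. x \<in> K \<Longrightarrow> \<bar>f x - g x\<bar> < inverse (real (Suc n))"
      using Stone_Weierstrass_real_polynomial_function[OF assms, of "inverse (real (Suc n))"]
      by auto
    then obtain a m where "g = (\<lambda>x. \<Sum>i\<le>m. a i * x ^ i)"
      unfolding real_polynomial_function_iff_sum by blast
    then have "g = poly (\<Sum>i\<le>m. monom (a i) i)" by (simp add: poly_sum poly_monom fun_eq_iff)
    then show ?thesis using g by blast
  qed
  then obtain p where p: "\<And>n x. x \<in> K \<Longrightarrow> \<bar>f x - poly (p n) x\<bar> < inverse (real (Suc n))" by metis
  have "uniform_limit K (\<lambda>n. poly (p n)) f sequentially"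
  proof (rule uniform_limitI)
    fix e :: real assume "e > 0"
    then obtain N where N: "inverse (real (Suc N)) < e" using reals_Archimedean by blast
    have "dist (poly (p n) x) (f x) < e" if "n \<ge> N" "x \<in> K" for n x
    proof -
      have "inverse (real (Suc n)) \<le> inverse (real (Suc N))" using that by simp
      then show ?thesis using p[OF that(2), of n] N
        unfolding dist_real_def abs_minus_commute[of "poly (p n) x"] by linarith
    qed
    then show "\<forall>\<^sub>F n in sequentially. \<forall>x\<in>K. dist (poly (p n) x) (f x) < e"
      unfolding eventually_sequentially by blast
  qed
  then show thesis by (rule that)
qed

section \<open>Continuous functional calculus\<close>

text \<open>Polynomials close to \<open>f\<close> on the spectrum give operators close in norm, so
  approximating sequences are Cauchy and share one limit. Uniqueness also depends on having at least
  one such sequence: otherwise the condition would hold vacuously for every operator.\<close>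

lemma cfc_well_defined:
  fixes T :: "'a::complex_hilbert op"
  assumes sa: "selfadjoint T" and f: "continuous_on (op_spectrum T) f"
  shows "\<exists>!S. \<forall>p :: nat \<Rightarrow> real poly.
     uniform_limit (op_spectrum T) (\<lambda>n. poly (p n)) f sequentially \<longrightarrow>
     (\<lambda>n. poly_op (p n) T) \<longlonglongrightarrow> S"
proof -
  let ?K = "op_spectrum T"
  obtain p where p: "uniform_limit ?K (\<lambda>n. poly (p n)) f sequentially"
    using uniform_limit_polys[OF compact_op_spectrum[OF sa] f] by blast
  have close: "norm (poly_op q T - poly_op r T) \<le> 2 * e"
    if "e > 0" "\<forall>x\<in>?K. dist (poly q x) (f x) < e" "\<forall>x\<in>?K. dist (poly r x) (f x) < e" for q r e
    unfolding poly_op_diff[symmetric]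
  proof (rule norm_poly_op_le[OF sa])
    fix l assume "l \<in> ?K"
    then show "\<bar>poly (q - r) l\<bar> \<le> 2 * e"
      using that(2,3)[rule_format, of l] by (simp add: dist_real_def)
  qed (use that in simp)
  have "Cauchy (\<lambda>n. poly_op (p n) T)"
  proof (rule CauchyI)
    fix e :: real assume "e > 0"
    then obtain N where N: "\<And>n. n \<ge> N \<Longrightarrow> \<forall>x\<in>?K. dist (poly (p n) x) (f x) < e / 3"
      using uniform_limitD[OF p, of "e / 3"] by (auto simp: eventually_sequentially)
    have "norm (poly_op (p m) T - poly_op (p n) T) < e" if "m \<ge> N" "n \<ge> N" for m n
      using close[of "e / 3", OF _ N[OF that(1)] N[OF that(2)]] \<open>e > 0\<close> by simp
    then show "\<exists>N. \<forall>m\<ge>N. \<forall>n\<ge>N. norm (poly_op (p m) T - poly_op (p n) T) < e" by blast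
  qed
  then obtain S where S: "(\<lambda>n. poly_op (p n) T) \<longlonglongrightarrow> S"
    using Cauchy_convergent convergent_def by blast
  have "(\<lambda>n. poly_op (q n) T) \<longlonglongrightarrow> S" if q: "uniform_limit ?K (\<lambda>n. poly (q n)) f sequentially" for q
  proof -
    have "(\<lambda>n. poly_op (q n) T - poly_op (p n) T) \<longlonglongrightarrow> 0"
    proof (rule tendstoI)
      fix e :: real assume "e > 0"
      then have "e / 3 > 0" by simp
      from eventually_conj[OF uniform_limitD[OF q this] uniform_limitD[OF p this]]
      show "\<forall>\<^sub>F n in sequentially. dist (poly_op (q n) T - poly_op (p n) T) 0 < e"
      proof eventually_elim
        case (elim n)
        then show ?case using close[of "e / 3" "q n" "p n"] \<open>e > 0\<close> by simp
      qed
    qed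
    from tendsto_add[OF this S] show ?thesis by simp
  qed
  then show ?thesis
    by (intro ex1I[of _ S]) (use LIMSEQ_unique[OF S] p in blast)+
qed

lemma poly_op_tendsto_cfc:
  assumes "selfadjoint T" "continuous_on (op_spectrum T) f"
    and "uniform_limit (op_spectrum T) (\<lambda>n. poly (p n)) f sequentially"
  shows "(\<lambda>n. poly_op (p n) T) \<longlonglongrightarrow> cfc f T"
  using theI'[OF cfc_well_defined[OF assms(1,2)]] assms(3) unfolding cfc_def by blast

lemma obtain_cfc_polys:
  assumes "selfadjoint T" "continuous_on (op_spectrum T) f"
  obtains p where "uniform_limit (op_spectrum T) (\<lambda>n. poly (p n)) f sequentially"
    "(\<lambda>n. poly_op (p n) T) \<longlonglongrightarrow> cfc f T"
  using uniform_limit_polys[OF compact_op_spectrum[OF assms(1)] assms(2)]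
    poly_op_tendsto_cfc[OF assms] by metis

lemma cfc_cong:
  assumes "\<And>x. x \<in> op_spectrum T \<Longrightarrow> f x = g x"
  shows "cfc f T = cfc g T"
proof -
  have "uniform_limit (op_spectrum T) F f sequentially
    \<longleftrightarrow> uniform_limit (op_spectrum T) F g sequentially" for F :: "nat \<Rightarrow> real \<Rightarrow> real"
    by (rule uniform_limit_cong') (use assms in auto)
  then show ?thesis by (simp add: cfc_def)
qed

lemma cfc_poly: "selfadjoint T \<Longrightarrow> cfc (poly p) T = poly_op p T"
  using poly_op_tendsto_cfc[of T "poly p" "\<lambda>_. p"]
  by (simp add: LIMSEQ_const_iff uniform_limit_const continuous_on_poly[OF continuous_on_id])

lemma cfc_ident: "selfadjoint T \<Longrightarrow> cfc (\<lambda>x. x) T = T"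
proof -
  have "poly [:0, 1:] = (\<lambda>x::real. x)" by (simp add: fun_eq_iff)
  then show "selfadjoint T \<Longrightarrow> ?thesis" using cfc_poly[of T "[:0, 1:]"] by (simp add: poly_op_pCons)
qed

lemma cfc_const: "selfadjoint T \<Longrightarrow> cfc (\<lambda>x. c) T = c *\<^sub>R id_blinfun"
proof -
  have "poly [:c:] = (\<lambda>x. c)" by (simp add: fun_eq_iff)
  then show "selfadjoint T \<Longrightarrow> ?thesis" using cfc_poly[of T "[:c:]"] by (simp add: poly_op_pCons)
qed

lemma cfc_add:
  assumes T: "selfadjoint T" and f: "continuous_on (op_spectrum T) f"
    and g: "continuous_on (op_spectrum T) g"
  shows "cfc (\<lambda>x. f x + g x) T = cfc f T + cfc g T"
proof -
  obtain p where p: "uniform_limit (op_spectrum T) (\<lambda>n. poly (p n)) f sequentially"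
    "(\<lambda>n. poly_op (p n) T) \<longlonglongrightarrow> cfc f T" using obtain_cfc_polys[OF T f] .
  obtain q where q: "uniform_limit (op_spectrum T) (\<lambda>n. poly (q n)) g sequentially"
    "(\<lambda>n. poly_op (q n) T) \<longlonglongrightarrow> cfc g T" using obtain_cfc_polys[OF T g] .
  have "(\<lambda>n. poly_op (p n + q n) T) \<longlonglongrightarrow> cfc (\<lambda>x. f x + g x) T"
    using uniform_limit_add[OF p(1) q(1)]
    by (intro poly_op_tendsto_cfc T continuous_intros f g) (simp flip: poly_add)
  then show ?thesis
    using tendsto_add[OF p(2) q(2)] by (simp add: poly_op_add LIMSEQ_unique)
qed

lemma cfc_mult:
  assumes T: "selfadjoint T" and f: "continuous_on (op_spectrum T) f"
    and g: "continuous_on (op_spectrum T) g"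
  shows "cfc (\<lambda>x. f x * g x) T = cfc f T o\<^sub>L cfc g T"
proof -
  obtain p where p: "uniform_limit (op_spectrum T) (\<lambda>n. poly (p n)) f sequentially"
    "(\<lambda>n. poly_op (p n) T) \<longlonglongrightarrow> cfc f T" using obtain_cfc_polys[OF T f] .
  obtain q where q: "uniform_limit (op_spectrum T) (\<lambda>n. poly (q n)) g sequentially"
    "(\<lambda>n. poly_op (q n) T) \<longlonglongrightarrow> cfc g T" using obtain_cfc_polys[OF T g] .
  have "bounded (f ` op_spectrum T)" "bounded (g ` op_spectrum T)"
    by (intro compact_imp_bounded compact_continuous_image compact_op_spectrum T f g)+
  then have "(\<lambda>n. poly_op (p n * q n) T) \<longlonglongrightarrow> cfc (\<lambda>x. f x * g x) T"
    using uniform_lim_mult[OF p(1) q(1)]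
    by (intro poly_op_tendsto_cfc T continuous_intros f g) (simp flip: poly_mult)
  moreover have "(\<lambda>n. poly_op (p n) T o\<^sub>L poly_op (q n) T) \<longlonglongrightarrow> (cfc f T o\<^sub>L cfc g T)"
    by (rule bounded_bilinear.tendsto[OF bounded_bilinear_blinfun_compose p(2) q(2)])
  ultimately show ?thesis
    by (simp add: poly_op_mult LIMSEQ_unique)
qed

lemma cfc_scaleR:
  assumes T: "selfadjoint T" and f: "continuous_on (op_spectrum T) f"
  shows "cfc (\<lambda>x. c * f x) T = c *\<^sub>R cfc f T"
  using cfc_mult[OF T continuous_on_const f, of c] by (simp add: cfc_const[OF T] op_distribs)

lemma cfc_diff:
  assumes T: "selfadjoint T" and f: "continuous_on (op_spectrum T) f"
    and g: "continuous_on (op_spectrum T) g"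
  shows "cfc (\<lambda>x. f x - g x) T = cfc f T - cfc g T"
proof -
  have "continuous_on (op_spectrum T) (\<lambda>x. f x - g x)" by (intro continuous_intros f g)
  from cfc_add[OF T this g] show ?thesis by simp
qed

lemma selfadjoint_cfc:
  assumes "selfadjoint T" "continuous_on (op_spectrum T) f"
  shows "selfadjoint (cfc f T)"
  using obtain_cfc_polys[OF assms] selfadjoint_tendsto selfadjoint_poly_op[OF assms(1)] by metis

lemma cfc_commute:
  assumes T: "selfadjoint T" and f: "continuous_on (op_spectrum T) f" and "S o\<^sub>L T = T o\<^sub>L S"
  shows "S o\<^sub>L cfc f T = cfc f T o\<^sub>L S"
proof -
  obtain p where p: "(\<lambda>n. poly_op (p n) T) \<longlonglongrightarrow> cfc f T" using obtain_cfc_polys[OF T f] .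
  have "(\<lambda>n. S o\<^sub>L poly_op (p n) T) \<longlonglongrightarrow> (S o\<^sub>L cfc f T)"
    "(\<lambda>n. poly_op (p n) T o\<^sub>L S) \<longlonglongrightarrow> (cfc f T o\<^sub>L S)"
    by (intro bounded_bilinear.tendsto[OF bounded_bilinear_blinfun_compose] tendsto_const p)+
  then show ?thesis
    unfolding poly_op_commute[OF assms(3)] by (rule LIMSEQ_unique)
qed

lemma cfc_commute_cfc:
  assumes T: "selfadjoint T" and f: "continuous_on (op_spectrum T) f"
    and g: "continuous_on (op_spectrum T) g"
  shows "cfc f T o\<^sub>L cfc g T = cfc g T o\<^sub>L cfc f T"
  using cfc_mult[OF T f g] cfc_mult[OF T g f] by (simp add: mult.commute)

text \<open>On the spectrum \<open>f\<close> is the square of a real continuous function, so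
  \<open>cfc f T\<close> is the square of a self-adjoint operator.\<close>

lemma positive_op_cfc:
  assumes T: "selfadjoint T" and f: "continuous_on (op_spectrum T) f"
    and nonneg: "\<And>x. x \<in> op_spectrum T \<Longrightarrow> 0 \<le> f x"
  shows "positive_op (cfc f T)"
proof -
  have s: "continuous_on (op_spectrum T) (\<lambda>x. sqrt (f x))" by (intro continuous_intros f)
  have "cfc f T = cfc (\<lambda>x. sqrt (f x) * sqrt (f x)) T"
    by (rule cfc_cong) (simp add: nonneg)
  also have "\<dots> = cfc (\<lambda>x. sqrt (f x)) T o\<^sub>L cfc (\<lambda>x. sqrt (f x)) T"
    by (rule cfc_mult[OF T s s])
  finally show ?thesis using positive_op_square[OF selfadjoint_cfc[OF T s]] by simp
qed

lemma cfc_mono: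
  assumes T: "selfadjoint T" and f: "continuous_on (op_spectrum T) f"
    and g: "continuous_on (op_spectrum T) g"
    and le: "\<And>x. x \<in> op_spectrum T \<Longrightarrow> f x \<le> g x"
  shows "cfc f T \<sqsubseteq> cfc g T"
  unfolding op_le_def cfc_diff[OF T g f, symmetric]
  by (intro positive_op_cfc T continuous_intros f g) (simp add: le)

lemma norm_cfc_le:
  assumes T: "selfadjoint T" and f: "continuous_on (op_spectrum T) f"
    and c: "0 \<le> c" "\<And>x. x \<in> op_spectrum T \<Longrightarrow> \<bar>f x\<bar> \<le> c"
  shows "norm (cfc f T) \<le> c"
proof (rule norm_blinfun_bound[OF c(1)])
  fix x
  have "cfc (\<lambda>x. f x * f x) T \<sqsubseteq> cfc (\<lambda>x. c * c) T"
  proof (rule cfc_mono[OF T])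
    show "f x * f x \<le> c * c" if "x \<in> op_spectrum T" for x
      using mult_mono[OF c(2)[OF that] c(2)[OF that]] c(1) by (simp add: abs_mult_self_eq)
  qed (intro continuous_intros f)+
  then have "inner x ((cfc f T o\<^sub>L cfc f T) x) \<le> inner x (((c * c) *\<^sub>R id_blinfun) x)"
    unfolding cfc_mult[OF T f f] cfc_const[OF T] by (rule op_le_inner)
  then have "(norm (cfc f T x))\<^sup>2 \<le> (c * norm x)\<^sup>2"
    using selfadjoint_inner[OF selfadjoint_cfc[OF T f], of x "cfc f T x"]
    by (simp add: blinfun.bilinear_simps power_mult_distrib power2_norm_eq_inner power2_eq_square[of c])
  then show "norm (cfc f T x) \<le> c * norm x"
    by (rule power2_le_imp_le) (use c(1) in simp)
qed

lemma cfc_tendsto: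
  assumes T: "selfadjoint T" and f: "continuous_on (op_spectrum T) f"
    and F: "\<And>n. continuous_on (op_spectrum T) (F n)"
    and lim: "uniform_limit (op_spectrum T) F f sequentially"
  shows "(\<lambda>n. cfc (F n) T) \<longlonglongrightarrow> cfc f T"
proof (rule tendstoI)
  fix e :: real assume "e > 0"
  then have "e / 2 > 0" by simp
  from uniform_limitD[OF lim this]
  show "\<forall>\<^sub>F n in sequentially. dist (cfc (F n) T) (cfc f T) < e"
  proof eventually_elim
    case (elim n)
    have "norm (cfc (\<lambda>x. F n x - f x) T) \<le> e / 2"
      by (intro norm_cfc_le T continuous_intros f F)
        (use elim \<open>e > 0\<close> in \<open>auto simp: dist_real_def intro: less_imp_le\<close>)
    then show ?case using \<open>e > 0\<close> by (simp add: dist_norm cfc_diff[OF T F f])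
  qed
qed

lemma cfc_inverse:
  assumes T: "selfadjoint T" and f: "continuous_on (op_spectrum T) f"
    and g: "continuous_on (op_spectrum T) g"
    and inv: "\<And>x. x \<in> op_spectrum T \<Longrightarrow> f x * g x = 1"
  shows "cfc f T o\<^sub>L cfc g T = id_blinfun"
  using cfc_cong[of T "\<lambda>x. f x * g x" "\<lambda>_. 1"] inv
  by (simp add: cfc_mult[OF T f g] cfc_const[OF T])

lemma op_invertible_cfc:
  assumes T: "selfadjoint T" and f: "continuous_on (op_spectrum T) f"
    and "\<And>x. x \<in> op_spectrum T \<Longrightarrow> f x \<noteq> 0"
  shows "op_invertible (cfc f T)"
proof -
  have g: "continuous_on (op_spectrum T) (\<lambda>x. inverse (f x))"
    by (intro continuous_intros f) (use assms in auto)
  have "cfc f T o\<^sub>L cfc (\<lambda>x. inverse (f x)) T = id_blinfun"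
    by (rule cfc_inverse[OF T f g]) (use assms in auto)
  moreover from this have "cfc (\<lambda>x. inverse (f x)) T o\<^sub>L cfc f T = id_blinfun"
    by (simp add: cfc_commute_cfc[OF T f g])
  ultimately show ?thesis unfolding op_invertible_def by blast
qed

section \<open>Operator logarithm and Hilbert-Schmidt norm\<close>

lemma op_adjoint_selfadjoint:
  assumes "selfadjoint K"
  shows "op_adjoint K = K"
  unfolding op_adjoint_def
proof (rule the_equality)
  show "\<forall>x y. cinner (K x) y = cinner x (K y)" using assms by (simp add: selfadjoint_def)
  fix S :: "'a op" assume S: "\<forall>x y. cinner (S x) y = cinner x (K y)"
  have "inner (S x) y = inner (K x) y" for x y
    using S[rule_format, of x y] by (metis Re_cinner assms selfadjoint_inner)
  then show "S = K" by (intro blinfun_eqI) (metis inner_commute vector_eq_ldot)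
qed

lemma hs_norm_mono:
  assumes K: "selfadjoint K" and L: "selfadjoint L" and le: "\<And>x. norm (K x) \<le> norm (L x)"
  shows "hs_norm K \<le> hs_norm L"
proof -
  have sq: "Re (cinner x ((op_adjoint T o\<^sub>L T) x)) = (norm (T x))\<^sup>2" if "selfadjoint T" for T :: "'a op" and x
    using selfadjoint_inner[OF that, of x "T x"]
    by (simp add: op_adjoint_selfadjoint[OF that] Re_cinner power2_norm_eq_inner)
  \<comment> \<open>Both traces run over the same family \<open>SOME E. is_onb E\<close>, and sums
    in \<open>ennreal\<close> always exist, so a termwise comparison works whether or not they are
    finite.\<close>
  have tr: "op_trace (op_adjoint K o\<^sub>L K) \<le> op_trace (op_adjoint L o\<^sub>L L)"
    unfolding op_trace_def sq[OF K] sq[OF L]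
    by (intro infsum_mono nonneg_summable_on_complete ennreal_leI power_mono le) auto
  show ?thesis
  proof (cases "op_trace (op_adjoint L o\<^sub>L L) = \<infinity>")
    case False
    with tr have "op_trace (op_adjoint K o\<^sub>L K) \<noteq> \<infinity>" by (auto simp: top_unique)
    then show ?thesis using False tr
      by (auto simp: hs_norm_def Let_def less_top intro!: ennreal_leI real_sqrt_le_mono enn2real_mono)
  qed (simp add: hs_norm_def)
qed

lemma op_invertible_ge:
  fixes T :: "'a::complex_hilbert op"
  assumes "selfadjoint T" "c > 0" "\<And>x. c * (norm x)\<^sup>2 \<le> inner x (T x)"
  shows "op_invertible T"
proof (rule selfadjoint_bounded_below_invertible[OF assms(1,2)])
  show "c * norm x \<le> norm (T x)" for x
  proof (cases "x = 0")
    case False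
    have "c * (norm x)\<^sup>2 \<le> norm x * norm (T x)"
      using assms(3) norm_cauchy_schwarz by (rule order_trans)
    then have "norm x * (c * norm x) \<le> norm x * norm (T x)"
      by (simp add: power2_eq_square algebra_simps)
    then show ?thesis by (rule mult_left_le_imp_le) (use False in simp)
  qed simp
qed

section \<open>Powers of a positive invertible operator\<close>

lemma continuous_on_spectrum_powr:
  assumes "positive_op T" "op_invertible T"
  shows "continuous_on (op_spectrum T) (\<lambda>x. x powr r)"
  by (intro continuous_intros) (use op_spectrum_pos[OF assms] in force)

lemma op_powr_mult:
  assumes T: "positive_op T" "op_invertible T"
  shows "op_powr T r o\<^sub>L op_powr T s = op_powr T (r + s)"
  unfolding op_powr_def
  by (subst cfc_mult[symmetric, OF positive_op_selfadjoint[OF T(1)]])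
    (auto simp: powr_add intro!: continuous_on_spectrum_powr T cfc_cong)

lemma op_powr_0:
  assumes T: "positive_op T" "op_invertible T"
  shows "op_powr T 0 = id_blinfun"
proof -
  have "op_powr T 0 = cfc (\<lambda>_. 1) T"
    unfolding op_powr_def by (rule cfc_cong) (use op_spectrum_pos[OF T] in force)
  then show ?thesis by (simp add: cfc_const[OF positive_op_selfadjoint[OF T(1)]])
qed

lemma op_powr_1:
  assumes T: "positive_op T" "op_invertible T"
  shows "op_powr T 1 = T"
proof -
  have "op_powr T 1 = cfc (\<lambda>x. x) T"
    unfolding op_powr_def by (rule cfc_cong) (use op_spectrum_pos[OF T] in force)
  then show ?thesis by (simp add: cfc_ident[OF positive_op_selfadjoint[OF T(1)]])
qed

lemma positive_op_powr:
  assumes T: "positive_op T" "op_invertible T"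
  shows "positive_op (op_powr T r)"
  unfolding op_powr_def
  by (intro positive_op_cfc continuous_on_spectrum_powr positive_op_selfadjoint T) auto

lemma op_powr_half:
  assumes T: "positive_op T" "op_invertible T"
  shows "op_powr T (1/2) o\<^sub>L op_powr T (1/2) = T"
    "op_powr T (-1/2) o\<^sub>L op_powr T (1/2) = id_blinfun"
    "op_powr T (1/2) o\<^sub>L op_powr T (-1/2) = id_blinfun"
  using op_powr_mult[OF T, of "1/2" "1/2"] op_powr_mult[OF T, of "-1/2" "1/2"]
    op_powr_mult[OF T, of "1/2" "-1/2"] by (simp_all add: op_powr_0[OF T] op_powr_1[OF T])

lemma op_powr_commute:
  assumes T: "positive_op T" "op_invertible T" and "S o\<^sub>L T = T o\<^sub>L S"
  shows "S o\<^sub>L op_powr T r = op_powr T r o\<^sub>L S"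
  unfolding op_powr_def
  by (intro cfc_commute continuous_on_spectrum_powr positive_op_selfadjoint assms)

lemma op_invertible_powr_half:
  assumes "positive_op T" "op_invertible T"
  shows "op_invertible (op_powr T (1/2))" "op_invertible (op_powr T (-1/2))"
  using op_powr_half[OF assms] unfolding op_invertible_def by blast+

text \<open>\<open>inner x (T x)\<close> is the square of \<open>norm (R x)\<close> for the root
  \<open>R\<close> of \<open>T\<close>, which is again invertible and so bounded below.\<close>

lemma positive_op_invertible_ge:
  assumes T: "positive_op T" "op_invertible T"
  obtains c where "c > 0" "\<And>x. c * (norm x)\<^sup>2 \<le> inner x (T x)"
proof -
  define R where "R = op_powr T (1/2)"
  have R: "selfadjoint R" "R o\<^sub>L R = T" "op_invertible R"
    using positive_op_powr[OF T] op_powr_half[OF T] op_invertible_powr_half[OF T]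
    by (auto simp: R_def intro: positive_op_selfadjoint)
  obtain c where c: "c > 0" "\<And>x. c * norm x \<le> norm (R x)"
    using op_invertible_bounded_below[OF R(3)] by blast
  have "c\<^sup>2 * (norm x)\<^sup>2 \<le> inner x (T x)" for x
  proof -
    have "(c * norm x)\<^sup>2 \<le> (norm (R x))\<^sup>2" using c by (intro power_mono) auto
    then show ?thesis
      using selfadjoint_inner[OF R(1), of x "R x"]
      by (simp add: R(2)[symmetric] power_mult_distrib power2_norm_eq_inner)
  qed
  then show thesis using that[of "c\<^sup>2"] c(1) by simp
qed

lemma positive_op_mono: "positive_op S \<Longrightarrow> S \<sqsubseteq> T \<Longrightarrow> positive_op T"
  using positive_op_add[of S "T - S"] by (simp add: op_le_def)

lemma op_invertible_mono:
  assumes S: "positive_op S" "op_invertible S" and T: "selfadjoint T" and le: "S \<sqsubseteq> T"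
  shows "op_invertible T"
proof -
  obtain c where "c > 0" "\<And>x. c * (norm x)\<^sup>2 \<le> inner x (S x)"
    using positive_op_invertible_ge[OF S] by blast
  then show ?thesis
    using op_invertible_ge[OF T] op_le_inner[OF le] order_trans by blast
qed

section \<open>Order of commuting operators, roots and logarithm\<close>

lemma cfc_compose_commute:
  assumes S: "selfadjoint S" and T: "selfadjoint T" and ST: "S o\<^sub>L T = T o\<^sub>L S"
    and f: "continuous_on (op_spectrum S) f" and g: "continuous_on (op_spectrum T) g"
  shows "cfc f S o\<^sub>L cfc g T = cfc g T o\<^sub>L cfc f S"
  using cfc_commute[OF S f, of "cfc g T"] cfc_commute[OF T g ST] by simp

text \<open>The root \<open>R\<close> of \<open>S\<close> commutes with \<open>T\<close>, so
  \<open>S T = R T R\<close>, a congruence of a positive operator.\<close>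

lemma positive_op_compose:
  assumes S: "positive_op S" and T: "positive_op T" and ST: "S o\<^sub>L T = T o\<^sub>L S"
  shows "positive_op (S o\<^sub>L T)"
proof -
  define R where "R = cfc sqrt S"
  have sa: "selfadjoint S" and c: "continuous_on (op_spectrum S) sqrt"
    using S by (auto intro: positive_op_selfadjoint continuous_intros)
  have "R o\<^sub>L R = cfc (\<lambda>x. sqrt x * sqrt x) S"
    unfolding R_def by (rule cfc_mult[OF sa c c, symmetric])
  also have "\<dots> = cfc (\<lambda>x. x) S"
    by (rule cfc_cong) (use op_spectrum_nonneg[OF S] in simp)
  finally have R: "R o\<^sub>L R = S" by (simp add: cfc_ident[OF sa])
  have "T o\<^sub>L R = R o\<^sub>L T"
    unfolding R_def by (rule cfc_commute[OF sa c]) (simp add: ST)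
  then have "S o\<^sub>L T = R o\<^sub>L T o\<^sub>L R"
    unfolding R[symmetric] op_compose_assoc by simp
  then show ?thesis
    using positive_op_conj[OF selfadjoint_cfc[OF sa c] T] by (simp add: R_def)
qed

text \<open>Because \<open>U\<close> and \<open>V\<close> commute,
  \<open>V\<^sup>2 - U\<^sup>2 = (V - U) W\<close> with \<open>W = V + U\<close>. Since
  \<open>V \<le> W\<close>, also \<open>W\<close> is invertible; conjugating by
  \<open>op_powr W (-1/2)\<close>, which commutes with \<open>V - U\<close>, leaves
  \<open>V - U\<close>.\<close>

lemma op_le_of_square_le:
  assumes U: "positive_op U" and V: "positive_op V" "op_invertible V" and UV: "U o\<^sub>L V = V o\<^sub>L U"
    and le: "U o\<^sub>L U \<sqsubseteq> V o\<^sub>L V"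
  shows "U \<sqsubseteq> V"
proof -
  define W where "W = V + U"
  define D where "D = V - U"
  have W: "positive_op W" unfolding W_def by (intro positive_op_add U V)
  have "V \<sqsubseteq> W" using U by (simp add: W_def op_le_def)
  then have W': "op_invertible W" by (rule op_invertible_mono[OF V positive_op_selfadjoint[OF W]])
  define G where "G = op_powr W (-1/2)"
  define H where "H = op_powr W (1/2)"
  have HG: "H o\<^sub>L H = W" "G o\<^sub>L H = id_blinfun" "H o\<^sub>L G = id_blinfun"
    unfolding G_def H_def by (rule op_powr_half[OF W W'])+
  have DW: "D o\<^sub>L W = (V o\<^sub>L V) - (U o\<^sub>L U)" "W o\<^sub>L D = (V o\<^sub>L V) - (U o\<^sub>L U)"
    unfolding D_def W_def op_distribs UV by simp_all
  then have DG: "D o\<^sub>L G = G o\<^sub>L D"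
    unfolding G_def by (intro op_powr_commute W W') simp
  have "positive_op (D o\<^sub>L W)" unfolding DW using le by (simp add: op_le_def)
  then have "positive_op (G o\<^sub>L (D o\<^sub>L W) o\<^sub>L G)"
    unfolding G_def by (intro positive_op_conj positive_op_selfadjoint positive_op_powr W W')
  also have "G o\<^sub>L (D o\<^sub>L W) o\<^sub>L G = (G o\<^sub>L D) o\<^sub>L (H o\<^sub>L H) o\<^sub>L G"
    by (simp only: HG(1) op_compose_assoc)
  also have "\<dots> = D o\<^sub>L (G o\<^sub>L H) o\<^sub>L (H o\<^sub>L G)"
    unfolding DG[symmetric] by (simp only: op_compose_assoc)
  finally show ?thesis by (simp add: HG D_def op_le_def)
qed

text \<open>With \<open>h = 1 / 2 ^ n\<close> and \<open>s = ln (u x)\<close> the approximant is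
  \<open>(exp (h * s) - 1) / h\<close>. It exceeds \<open>s\<close> by at most
  \<open>s * (exp (h * s) - 1)\<close>, hence by at most \<open>M * (exp (h * M) - 1)\<close>, where
  \<open>M\<close> bounds \<open>\<bar>s\<bar>\<close> on the compact set \<open>K\<close>. This
  bound is free of \<open>x\<close> and tends to 0.\<close>

lemma uniform_limit_ln:
  fixes u :: "real \<Rightarrow> real"
  assumes K: "compact K" and u: "continuous_on K u" and pos: "\<And>x. x \<in> K \<Longrightarrow> 0 < u x"
  shows "uniform_limit K (\<lambda>n x. 2 ^ n * (u x powr (1 / 2 ^ n) - 1)) (\<lambda>x. ln (u x)) sequentially"
proof -
  have "continuous_on K (\<lambda>x. ln (u x))" by (intro continuous_intros u) (use pos in force)
  then have "bounded ((\<lambda>x. ln (u x)) ` K)"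
    by (intro compact_imp_bounded compact_continuous_image K)
  then obtain M where M: "M > 0" "\<And>x. x \<in> K \<Longrightarrow> \<bar>ln (u x)\<bar> \<le> M"
    by (auto simp: bounded_pos)
  have bound: "\<bar>2 ^ n * (u x powr (1 / 2 ^ n) - 1) - ln (u x)\<bar> \<le> M * (exp (M / 2 ^ n) - 1)"
    if "x \<in> K" for x n
  proof -
    define s where "s = ln (u x)"
    define h :: real where "h = 1 / 2 ^ n"
    have h: "h > 0" "2 ^ n = 1 / h" by (simp_all add: h_def)
    have s: "\<bar>s\<bar> \<le> M" using M(2)[OF that] by (simp add: s_def)
    have e: "u x powr h = exp (h * s)" using pos[OF that] by (simp add: powr_def s_def)
    have lo: "h * s \<le> exp (h * s) - 1" using exp_ge_add_one_self[of "h * s"] by linarith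
    have "(1 + - (h * s)) * exp (h * s) \<le> exp (- (h * s)) * exp (h * s)"
      by (intro mult_right_mono exp_ge_add_one_self) simp
    also have "\<dots> = 1" by (simp flip: exp_add)
    finally have hi: "exp (h * s) - 1 \<le> h * s * exp (h * s)" by (simp add: algebra_simps)
    have abs_exp: "\<bar>exp y - 1\<bar> \<le> exp \<bar>y\<bar> - 1" for y :: real
    proof (cases "y \<ge> 0")
      case False
      then have "\<bar>exp y - 1\<bar> = 1 - exp y" "\<bar>y\<bar> = - y" by auto
      then show ?thesis
        using exp_ge_add_one_self[of y] exp_ge_add_one_self[of "-y"] by linarith
    qed simp
    have "\<bar>exp (h * s) - 1 - h * s\<bar> \<le> h * s * (exp (h * s) - 1)"
      using lo hi by (simp add: algebra_simps)
    also have "\<dots> \<le> h * \<bar>s\<bar> * \<bar>exp (h * s) - 1\<bar>"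
      using h(1) abs_ge_self[of "h * s * (exp (h * s) - 1)"] by (simp add: abs_mult)
    also have "\<dots> \<le> h * M * (exp \<bar>h * s\<bar> - 1)"
      using h s M(1) abs_exp by (intro mult_mono) auto
    also have "\<dots> \<le> h * M * (exp (h * M) - 1)"
      using h s M(1) by (intro mult_left_mono diff_right_mono) (auto simp: abs_mult)
    finally have "\<bar>exp (h * s) - 1 - h * s\<bar> / h \<le> M * (exp (h * M) - 1)"
      using h by (simp add: field_simps)
    moreover have "\<bar>exp (h * s) - 1 - h * s\<bar> / h = \<bar>1 / h * (exp (h * s) - 1) - s\<bar>"
      unfolding abs_div_pos[OF h(1)] using h(1) by (simp add: diff_divide_distrib)
    ultimately show ?thesis
      by (simp add: e h(2) s_def[symmetric] flip: h_def) (simp add: mult.commute)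
  qed
  have "(\<lambda>n. M * (exp (M / 2 ^ n) - 1)) \<longlonglongrightarrow> M * (exp 0 - 1)"
    by (intro tendsto_intros LIMSEQ_divide_realpow_zero) simp
  then have lim: "(\<lambda>n. M * (exp (M / 2 ^ n) - 1)) \<longlonglongrightarrow> 0" by simp
  show ?thesis
  proof (rule uniform_limitI)
    fix e :: real assume "e > 0"
    from order_tendstoD(2)[OF lim this]
    show "\<forall>\<^sub>F n in sequentially. \<forall>x\<in>K. dist (2 ^ n * (u x powr (1 / 2 ^ n) - 1)) (ln (u x)) < e"
      by eventually_elim (auto simp: dist_real_def intro: le_less_trans[OF bound])
  qed
qed

text \<open>Square roots preserve the order of commuting operators, and \<open>ln x\<close> is the limit of
  \<open>2\<^sup>n (x powr (1/2\<^sup>n) - 1)\<close>.\<close>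

lemma cfc_ln_mono:
  assumes S: "selfadjoint S" and T: "selfadjoint T" and ST: "S o\<^sub>L T = T o\<^sub>L S"
    and u: "continuous_on (op_spectrum S) u" "\<And>x. x \<in> op_spectrum S \<Longrightarrow> 0 < u x"
    and v: "continuous_on (op_spectrum T) v" "\<And>x. x \<in> op_spectrum T \<Longrightarrow> 0 < v x"
    and le: "cfc u S \<sqsubseteq> cfc v T"
  shows "cfc (\<lambda>x. ln (u x)) S \<sqsubseteq> cfc (\<lambda>x. ln (v x)) T"
proof -
  \<comment> \<open>The roots of \<open>cfc u S\<close> are formed as functions of \<open>S\<close>
    itself, so their limit is directly \<open>cfc (\<lambda>x. ln (u x)) S\<close>. This is why the
    lemma carries \<open>u\<close> and \<open>v\<close>.\<close>
  define U where "U n = cfc (\<lambda>x. u x powr (1 / 2 ^ n)) S" for n :: nat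
  define V where "V n = cfc (\<lambda>x. v x powr (1 / 2 ^ n)) T" for n :: nat
  have cu: "continuous_on (op_spectrum S) (\<lambda>x. u x powr r)" for r
    by (intro continuous_intros u) (use u(2) in force)
  have cv: "continuous_on (op_spectrum T) (\<lambda>x. v x powr r)" for r
    by (intro continuous_intros v) (use v(2) in force)
  have root: "w powr (1 / 2 ^ Suc n) * w powr (1 / 2 ^ Suc n) = w powr (1 / 2 ^ n)" for w :: real and n :: nat
    by (simp flip: powr_add)
  have U2: "U (Suc n) o\<^sub>L U (Suc n) = U n" for n
    unfolding U_def by (simp only: cfc_mult[OF S cu cu, symmetric] root)
  have V2: "V (Suc n) o\<^sub>L V (Suc n) = V n" for n
    unfolding V_def by (simp only: cfc_mult[OF T cv cv, symmetric] root)
  have UV: "U n \<sqsubseteq> V n" for n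
  proof (induction n)
    case 0
    have "U 0 = cfc u S" "V 0 = cfc v T"
      unfolding U_def V_def by (auto intro!: cfc_cong simp: u v less_imp_le)
    then show ?case using le by simp
  next
    case (Suc n)
    show ?case
    proof (rule op_le_of_square_le)
      show "positive_op (U (Suc n))" "positive_op (V (Suc n))"
        unfolding U_def V_def by (intro positive_op_cfc S T cu cv; simp)+
      show "op_invertible (V (Suc n))"
        unfolding V_def using v(2) by (intro op_invertible_cfc T cv) force
      show "U (Suc n) o\<^sub>L V (Suc n) = V (Suc n) o\<^sub>L U (Suc n)"
        unfolding U_def V_def by (intro cfc_compose_commute S T ST cu cv)
      show "U (Suc n) o\<^sub>L U (Suc n) \<sqsubseteq> V (Suc n) o\<^sub>L V (Suc n)"
        unfolding U2 V2 by (rule Suc)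
    qed
  qed
  have U': "cfc (\<lambda>x. 2 ^ n * (u x powr (1 / 2 ^ n) - 1)) S = 2 ^ n *\<^sub>R (U n - id_blinfun)" for n
    unfolding U_def
    by (subst cfc_scaleR[OF S] cfc_diff[OF S] cfc_const[OF S]; (intro continuous_intros cu)?)+
      simp
  have V': "cfc (\<lambda>x. 2 ^ n * (v x powr (1 / 2 ^ n) - 1)) T = 2 ^ n *\<^sub>R (V n - id_blinfun)" for n
    unfolding V_def
    by (subst cfc_scaleR[OF T] cfc_diff[OF T] cfc_const[OF T]; (intro continuous_intros cv)?)+
      simp
  have limU: "(\<lambda>n. 2 ^ n *\<^sub>R (U n - id_blinfun)) \<longlonglongrightarrow> cfc (\<lambda>x. ln (u x)) S"
    unfolding U'[symmetric]
    by (intro cfc_tendsto S uniform_limit_ln compact_op_spectrum continuous_intros u cu)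
      (use u(2) in force)
  have limV: "(\<lambda>n. 2 ^ n *\<^sub>R (V n - id_blinfun)) \<longlonglongrightarrow> cfc (\<lambda>x. ln (v x)) T"
    unfolding V'[symmetric]
    by (intro cfc_tendsto T uniform_limit_ln compact_op_spectrum continuous_intros v cv)
      (use v(2) in force)
  have "positive_op (2 ^ n *\<^sub>R (V n - id_blinfun) - 2 ^ n *\<^sub>R (U n - id_blinfun))" for n
    using positive_op_scaleR[of "V n - U n" "2 ^ n"] UV[of n]
    by (simp add: op_le_def scaleR_diff_right)
  then show ?thesis
    unfolding op_le_def by (rule positive_op_tendsto[OF _ tendsto_diff[OF limV limU]])
qed

text \<open>With \<open>N = ln (min 1 X)\<close> and \<open>P = ln (max 1 X)\<close> one has \<open>ln X = P + N\<close> and \<open>P N = 0\<close>, so for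
  \<open>K = ln Y\<close> the product of \<open>P - K \<ge> 0\<close> and \<open>K - N \<ge> 0\<close> is \<open>K (ln X) - K\<^sup>2\<close>.\<close>

lemma norm_op_log_le:
  assumes X: "positive_op X" "op_invertible X" and Y: "positive_op Y" "op_invertible Y"
    and comm: "X o\<^sub>L Y = Y o\<^sub>L X"
    and lo: "cfc (min 1) X \<sqsubseteq> Y" and hi: "Y \<sqsubseteq> cfc (max 1) X"
  shows "norm (op_log Y z) \<le> norm (op_log X z)"
proof -
  have sX: "selfadjoint X" and sY: "selfadjoint Y" using X Y by (auto intro: positive_op_selfadjoint)
  have pX: "x > 0" if "x \<in> op_spectrum X" for x using op_spectrum_pos[OF X that] .
  have pY: "x > 0" if "x \<in> op_spectrum Y" for x using op_spectrum_pos[OF Y that] .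
  have cmax: "continuous_on (op_spectrum X) (max 1)" and cmin: "continuous_on (op_spectrum X) (min 1)"
    by (intro continuous_intros)+
  have cln: "continuous_on (op_spectrum X) ln" "continuous_on (op_spectrum Y) ln"
    by (intro continuous_intros; use pX pY in force)+
  have clmax: "continuous_on (op_spectrum X) (\<lambda>x. ln (max 1 x))"
    and clmin: "continuous_on (op_spectrum X) (\<lambda>x. ln (min 1 x))"
    by (intro continuous_intros; use pX in force)+
  define P where "P = cfc (\<lambda>x. ln (max 1 x)) X"
  define N where "N = cfc (\<lambda>x. ln (min 1 x)) X"
  define K where "K = op_log Y"
  define L where "L = op_log X"
  have sa: "selfadjoint P" "selfadjoint N" "selfadjoint K" "selfadjoint L"
    unfolding P_def N_def K_def L_def op_log_def by (intro selfadjoint_cfc sX sY clmax clmin cln)+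
  have KP: "K o\<^sub>L P = P o\<^sub>L K" and KN: "K o\<^sub>L N = N o\<^sub>L K"
    unfolding K_def P_def N_def op_log_def
    by (intro cfc_compose_commute sX sY clmax clmin cln comm[symmetric])+
  have L: "L = P + N"
  proof -
    have "L = cfc (\<lambda>x. ln (max 1 x) + ln (min 1 x)) X"
      unfolding L_def op_log_def by (rule cfc_cong) (use pX in \<open>auto simp: max_def min_def\<close>)
    then show ?thesis by (simp add: P_def N_def cfc_add[OF sX clmax clmin])
  qed
  have PN: "P o\<^sub>L N = 0"
  proof -
    have "P o\<^sub>L N = cfc (\<lambda>x. ln (max 1 x) * ln (min 1 x)) X"
      unfolding P_def N_def by (rule cfc_mult[OF sX clmax clmin, symmetric])
    also have "\<dots> = cfc (\<lambda>x. 0) X" by (rule cfc_cong) (auto simp: max_def min_def)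
    finally show ?thesis by (simp add: cfc_const[OF sX])
  qed
  have "K \<sqsubseteq> P"
    unfolding K_def P_def op_log_def
    by (rule cfc_ln_mono[OF sY sX comm[symmetric], of "\<lambda>x. x"])
      (use hi pX pY in \<open>auto intro: cmax simp: cfc_ident[OF sY] less_max_iff_disj\<close>)
  moreover have "N \<sqsubseteq> K"
    unfolding K_def N_def op_log_def
    by (rule cfc_ln_mono[OF sX sY comm, of _ "\<lambda>x. x"])
      (use lo pX pY in \<open>auto intro: cmin simp: cfc_ident[OF sY]\<close>)
  moreover have "P o\<^sub>L N = N o\<^sub>L P"
    unfolding P_def N_def by (rule cfc_commute_cfc[OF sX clmax clmin])
  then have "(P - K) o\<^sub>L (K - N) = (K - N) o\<^sub>L (P - K)"
    unfolding op_distribs KP KN by (simp add: algebra_simps)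
  ultimately have "positive_op ((P - K) o\<^sub>L (K - N))"
    unfolding op_le_def by (intro positive_op_compose)
  also have "(P - K) o\<^sub>L (K - N) = (K o\<^sub>L L) - (K o\<^sub>L K)"
    unfolding L op_distribs PN KP by (simp add: algebra_simps)
  finally have "0 \<le> inner z (((K o\<^sub>L L) - (K o\<^sub>L K)) z)" by (simp add: positive_op_iff)
  then have "(norm (K z))\<^sup>2 \<le> inner (K z) (L z)"
    by (simp add: blinfun.bilinear_simps inner_diff_right power2_norm_eq_inner
        selfadjoint_inner[OF sa(3)])
  also have "\<dots> \<le> norm (K z) * norm (L z)" by (rule norm_cauchy_schwarz)
  finally have "norm (K z) * norm (K z) \<le> norm (K z) * norm (L z)"
    by (simp add: power2_eq_square)
  then have "norm (K z) \<le> norm (L z)"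
    by (cases "norm (K z) = 0") (auto dest: mult_left_le_imp_le)
  then show ?thesis by (simp add: K_def L_def)
qed

section \<open>Means defined by the axioms\<close>

text \<open>The square of \<open>norm (cfc f T z)\<close> is the quadratic form at \<open>z\<close>
  of the squared function of \<open>T\<close>, and the squares are ordered on the spectrum.\<close>

lemma norm_cfc_apply_mono:
  assumes T: "selfadjoint T" and f: "continuous_on (op_spectrum T) f"
    and g: "continuous_on (op_spectrum T) g"
    and le: "\<And>x. x \<in> op_spectrum T \<Longrightarrow> \<bar>f x\<bar> \<le> \<bar>g x\<bar>"
  shows "norm (cfc f T z) \<le> norm (cfc g T z)"
proof -
  have sq: "inner z (cfc (\<lambda>x. h x * h x) T z) = (norm (cfc h T z))\<^sup>2"
    if h: "continuous_on (op_spectrum T) h" for h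
    using selfadjoint_inner[OF selfadjoint_cfc[OF T h], of z "cfc h T z"]
    by (simp add: cfc_mult[OF T h h] power2_norm_eq_inner)
  have "cfc (\<lambda>x. f x * f x) T \<sqsubseteq> cfc (\<lambda>x. g x * g x) T"
    using le by (intro cfc_mono T continuous_intros f g) (metis abs_le_square_iff power2_eq_square)
  from op_le_inner[OF this, of z] have "(norm (cfc f T z))\<^sup>2 \<le> (norm (cfc g T z))\<^sup>2"
    by (simp only: sq[OF f] sq[OF g])
  then show ?thesis by (rule power2_le_imp_le) simp
qed

text \<open>Split \<open>z\<close> by a partition of unity of \<open>N + 1\<close> hat functions of \<open>R\<close> of width \<open>\<delta> = 2M/N\<close>: on each
  piece \<open>R\<close> is within \<open>\<delta>\<close> of a scalar, so \<open>\<parallel>D z\<parallel>\<^sup>2 \<le> (N + 1) \<delta>\<^sup>2 \<parallel>z\<parallel>\<^sup>2\<close>, which tends to \<open>0\<close>.\<close>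

lemma dominated_by_all_shifts_eq_0:
  fixes R D :: "'a::complex_hilbert op"
  assumes R: "selfadjoint R"
    and D: "\<And>t z. norm (D z) \<le> norm ((R - t *\<^sub>R id_blinfun) z)"
  shows "D = 0"
proof -
  obtain M where M: "M > 0" "\<And>x. x \<in> op_spectrum R \<Longrightarrow> \<bar>x\<bar> \<le> M"
    using compact_imp_bounded[OF compact_op_spectrum[OF R]] by (auto simp: bounded_pos)
  have bound: "(norm (D z))\<^sup>2 \<le> 8 * M\<^sup>2 * (norm z)\<^sup>2 / real N" if N: "N > 0" for N z
  proof -
    define \<delta> where "\<delta> = 2 * M / real N"
    have \<delta>: "\<delta> > 0" "real N * \<delta> = 2 * M" using N M by (simp_all add: \<delta>_def)
    \<comment> \<open>\<open>r i\<close> is a ramp rising from 0 to 1 between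
      \<open>t i - \<delta>\<close> and \<open>t i\<close>, so the difference \<open>h i\<close> is
      a hat with peak at \<open>t i\<close>. On the spectrum \<open>r 0\<close> is 1 and
      \<open>r (Suc N)\<close> is 0, hence the hats telescope to 1.\<close>
    define r where "r i x = min 1 (max 0 ((x + M) / \<delta> - real i + 1))" for i :: nat and x :: real
    define h where "h i x = r i x - r (Suc i) x" for i x
    define t where "t i = real i * \<delta> - M" for i
    have cr: "continuous_on K (r i)" for K i
      unfolding r_def using \<delta> by (intro continuous_intros) auto
    then have ch: "continuous_on K (h i)" for K i unfolding h_def by (intro continuous_intros)
    have h01: "0 \<le> h i x" "h i x \<le> 1" for i x by (auto simp: h_def r_def)
    have supp: "\<bar>x - t i\<bar> \<le> \<delta>" if "h i x \<noteq> 0" for i x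
    proof -
      have "\<bar>(x + M) / \<delta> - real i\<bar> \<le> 1"
        using that by (auto simp: h_def r_def min_def max_def split: if_splits)
      moreover have "x - t i = \<delta> * ((x + M) / \<delta> - real i)"
        using \<delta>(1) by (simp add: t_def right_diff_distrib)
      ultimately show ?thesis using \<delta>(1) by (simp add: abs_mult mult_left_le)
    qed
    define H where "H i = cfc (h i) R" for i
    have H_eq: "H i = cfc (r i) R - cfc (r (Suc i)) R" for i
      unfolding H_def h_def by (rule cfc_diff[OF R cr cr])
    have "cfc (r 0) R = cfc (\<lambda>_. 1) R"
    proof (rule cfc_cong)
      fix x assume "x \<in> op_spectrum R"
      then have "(x + M) / \<delta> \<ge> 0" using M(2)[of x] \<delta>(1) by simp
      then show "r 0 x = 1" by (simp add: r_def)
    qed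
    moreover have "cfc (r (Suc N)) R = cfc (\<lambda>_. 0) R"
    proof (rule cfc_cong)
      fix x assume "x \<in> op_spectrum R"
      then have "x + M \<le> real N * \<delta>" using M(2)[of x] \<delta>(2) by simp
      then have "(x + M) / \<delta> \<le> real N" using \<delta>(1) by (simp add: field_simps)
      then show "r (Suc N) x = 0" by (simp add: r_def)
    qed
    ultimately have sumH: "(\<Sum>i<Suc N. H i) = id_blinfun"
      unfolding H_eq sum_lessThan_telescope'[of "\<lambda>i. cfc (r i) R" "Suc N"]
      by (simp add: cfc_const[OF R])
    have "norm (D z) = norm (\<Sum>i<Suc N. D (H i z))"
      using arg_cong[OF sumH, of "\<lambda>T. D (T z)"]
      by (simp only: blinfun.sum_left blinfun.sum_right blinfun_apply_id_blinfun)
    also have "\<dots> \<le> (\<Sum>i<Suc N. norm (D (H i z)))" by (rule norm_sum)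
    also have "\<dots> \<le> (\<Sum>i<Suc N. \<delta> * norm (H i z))"
    proof (rule sum_mono)
      fix i
      have "norm (D (H i z)) \<le> norm ((R - t i *\<^sub>R id_blinfun) (H i z))" by (rule D)
      also have "(R - t i *\<^sub>R id_blinfun) (H i z) = cfc (\<lambda>x. (x - t i) * h i x) R z"
        unfolding H_def
        by (subst cfc_mult[OF R]; (intro continuous_intros ch)?)
          (subst cfc_diff[OF R]; (intro continuous_intros)?;
            simp add: cfc_ident[OF R] cfc_const[OF R])
      also have "norm \<dots> \<le> norm (cfc (\<lambda>x. \<delta> * h i x) R z)"
      proof (rule norm_cfc_apply_mono[OF R])
        show "\<bar>(x - t i) * h i x\<bar> \<le> \<bar>\<delta> * h i x\<bar>" for x
          using supp[of i x] \<delta>(1) by (cases "h i x = 0") (auto simp: abs_mult intro: mult_right_mono)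
      qed (intro continuous_intros ch)+
      also have "\<dots> = \<delta> * norm (H i z)"
        using \<delta>(1) by (simp add: cfc_scaleR[OF R ch] H_def blinfun.bilinear_simps)
      finally show "norm (D (H i z)) \<le> \<delta> * norm (H i z)" .
    qed
    finally have "norm (D z) \<le> (\<Sum>i<Suc N. \<delta> * norm (H i z))" .
    then have "(norm (D z))\<^sup>2 \<le> (\<Sum>i<Suc N. \<delta> * norm (H i z))\<^sup>2" by (rule power_mono) simp
    \<comment> \<open>Cauchy-Schwarz costs a factor \<open>N + 1\<close>, which the factor
      \<open>\<delta>\<^sup>2\<close> of order \<open>1 / N\<^sup>2\<close> outweighs.\<close>
    also have "\<dots> \<le> (\<Sum>i<Suc N. (\<delta> * norm (H i z))\<^sup>2) * card {..<Suc N}"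
      by (rule sum_squared_le_sum_of_squares)
    also have "\<dots> = \<delta>\<^sup>2 * (\<Sum>i<Suc N. (norm (H i z))\<^sup>2) * (real N + 1)"
      by (simp only: power_mult_distrib sum_distrib_left card_lessThan of_nat_Suc add.commute)
    \<comment> \<open>The pieces \<open>H i z\<close> need not be orthogonal;
      \<open>h\<^sup>2 \<le> h\<close> for hats with values in the unit interval replaces
      Pythagoras.\<close>
    also have "(\<Sum>i<Suc N. (norm (H i z))\<^sup>2) \<le> (\<Sum>i<Suc N. inner z (H i z))"
    proof (rule sum_mono)
      fix i
      have "cfc (\<lambda>x. h i x * h i x) R \<sqsubseteq> H i"
        unfolding H_def using h01 by (intro cfc_mono R continuous_intros ch) (simp add: mult_left_le)
      from op_le_inner[OF this, of z] show "(norm (H i z))\<^sup>2 \<le> inner z (H i z)"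
        using selfadjoint_inner[OF selfadjoint_cfc[OF R ch[of _ i]], of z "H i z"]
        by (simp add: cfc_mult[OF R ch ch] power2_norm_eq_inner H_def)
    qed
    also have "\<dots> = (norm z)\<^sup>2"
      using arg_cong[OF sumH, of "\<lambda>T. inner z (T z)"]
      by (simp only: blinfun.sum_left inner_sum_right blinfun_apply_id_blinfun power2_norm_eq_inner)
    finally have "(norm (D z))\<^sup>2 \<le> \<delta>\<^sup>2 * (norm z)\<^sup>2 * (real N + 1)"
      by (simp add: mult_left_mono mult_right_mono)
    \<comment> \<open>Origin of the constant 8:
      \<open>\<delta>\<^sup>2 = 4 * M\<^sup>2 / N\<^sup>2\<close> and
      \<open>N + 1 \<le> 2 * N\<close>.\<close>
    also have "\<dots> \<le> \<delta>\<^sup>2 * (norm z)\<^sup>2 * (2 * real N)"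
      using N by (intro mult_left_mono) auto
    also have "\<dots> = 8 * M\<^sup>2 * (norm z)\<^sup>2 / real N"
      using N by (simp add: \<delta>_def power2_eq_square field_simps)
    finally show ?thesis .
  qed
  have "D z = 0" for z
  proof -
    have "(\<lambda>N. 8 * M\<^sup>2 * (norm z)\<^sup>2 / real N) \<longlonglongrightarrow> 0" by (rule lim_const_over_n)
    moreover have "\<forall>\<^sub>F N in sequentially. (norm (D z))\<^sup>2 \<le> 8 * M\<^sup>2 * (norm z)\<^sup>2 / real N"
      using eventually_gt_at_top[of 0] by eventually_elim (rule bound)
    ultimately have "(norm (D z))\<^sup>2 \<le> 0"
      by (rule tendsto_lowerbound) simp
    then show ?thesis by simp
  qed
  then show ?thesis by (intro blinfun_eqI) simp
qed

text \<open>Put \<open>S = Y\<^bsup>-1/2\<^esup> X Y\<^bsup>1/2\<^esup>\<close> and \<open>R = (S + S*) / 2\<close>, \<open>D = (S - S*) / 2\<close>. The hypothesis is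
  \<open>\<parallel>D z\<parallel> \<le> \<parallel>(R - t) z\<parallel>\<close>, hence \<open>S = S*\<close>.\<close>

lemma commute_of_shifted_squares:
  assumes X: "selfadjoint X" and Y: "positive_op Y" "op_invertible Y"
    and nonneg: "\<And>t w. 0 \<le> inner ((X - t *\<^sub>R id_blinfun) ((X - t *\<^sub>R id_blinfun) w)) (Y w)"
  shows "X o\<^sub>L Y = Y o\<^sub>L X"
proof -
  define G where "G = op_powr Y (-1/2)"
  define Q where "Q = op_powr Y (1/2)"
  have sG: "selfadjoint G" and sQ: "selfadjoint Q"
    unfolding G_def Q_def by (intro positive_op_selfadjoint positive_op_powr Y)+
  have QQ: "Q o\<^sub>L Q = Y" and GQ: "G o\<^sub>L Q = id_blinfun" and QG: "Q o\<^sub>L G = id_blinfun"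
    unfolding G_def Q_def by (rule op_powr_half[OF Y])+
  have GQ': "G (Q x) = x" and QG': "Q (G x) = x" and Y': "Y x = Q (Q x)" for x
    by (metis GQ QG QQ blinfun_apply_blinfun_compose blinfun_apply_id_blinfun)+
  \<comment> \<open>The point of this choice: \<open>X Y = Q S Q\<close> and
    \<open>Y X = Q S' Q\<close>, so \<open>X\<close> and \<open>Y\<close> commute as soon as
    \<open>S = S'\<close>.\<close>
  define S where "S = G o\<^sub>L X o\<^sub>L Q"
  define S' where "S' = Q o\<^sub>L X o\<^sub>L G"
  have adj: "inner (S x) y = inner x (S' y)" "inner (S' x) y = inner x (S y)" for x y
    by (simp_all add: S_def S'_def selfadjoint_inner[OF sG] selfadjoint_inner[OF sQ]
        selfadjoint_inner[OF X])
  define R where "R = (1/2) *\<^sub>R (S + S')"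
  define D where "D = (1/2) *\<^sub>R (S - S')"
  have RD: "S = R + D" "S' = R - D"
    by (simp_all add: R_def D_def algebra_simps flip: scaleR_add_left)
  have "clinear_op S" "clinear_op S'"
    unfolding S_def S'_def by (intro clinear_op_compose selfadjoint_clinear sG sQ X)+
  then have "selfadjoint R"
    unfolding selfadjoint_iff R_def
    by (simp add: clinear_op_add clinear_op_scaleR blinfun.bilinear_simps inner_add_left
        inner_add_right adj)
  moreover have "norm (D z) \<le> norm ((R - t *\<^sub>R id_blinfun) z)" for t z
  proof -
    let ?Z = "X - t *\<^sub>R id_blinfun"
    have sZ: "selfadjoint ?Z" by (rule selfadjoint_shift[OF X])
    \<comment> \<open>Testing at \<open>G z\<close> and moving one factor \<open>Q\<close> and one
      \<open>?Z\<close> across turns the form into the inner product of \<open>(S' - t) z\<close>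
      and \<open>(S - t) z\<close>, a difference of two squares in terms of \<open>R\<close> and
      \<open>D\<close>.\<close>
    have "0 \<le> inner (?Z (?Z (G z))) (Y (G z))" by (rule nonneg)
    also have "\<dots> = inner (Q (?Z (G z))) (G (?Z (Q z)))"
      by (simp only: Y' QG' selfadjoint_inner[OF sZ] selfadjoint_inner[OF sQ])
    also have "Q (?Z (G z)) = (R - t *\<^sub>R id_blinfun) z - D z"
      using arg_cong[OF RD(2), of "\<lambda>T. T z"]
      by (simp add: S'_def blinfun.bilinear_simps QG')
    also have "G (?Z (Q z)) = (R - t *\<^sub>R id_blinfun) z + D z"
      using arg_cong[OF RD(1), of "\<lambda>T. T z"]
      by (simp add: S_def blinfun.bilinear_simps GQ')
    also have "inner (a - d) (a + d) = (norm a)\<^sup>2 - (norm d)\<^sup>2" for a d :: 'a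
      by (simp add: power2_norm_eq_inner inner_diff_left inner_diff_right inner_add_left
          inner_add_right inner_commute)
    finally have "(norm (D z))\<^sup>2 \<le> (norm ((R - t *\<^sub>R id_blinfun) z))\<^sup>2" by simp
    then show ?thesis by (rule power2_le_imp_le) simp
  qed
  ultimately have "D = 0" by (rule dominated_by_all_shifts_eq_0)
  then have "S = S'" by (simp add: RD)
  have "X o\<^sub>L Y = (Q o\<^sub>L G) o\<^sub>L X o\<^sub>L (Q o\<^sub>L Q)" by (simp add: QG QQ)
  also have "\<dots> = Q o\<^sub>L S o\<^sub>L Q" by (simp only: S_def op_compose_assoc)
  also have "\<dots> = Q o\<^sub>L S' o\<^sub>L Q" by (simp only: \<open>S = S'\<close>)
  also have "\<dots> = (Q o\<^sub>L Q) o\<^sub>L X o\<^sub>L (G o\<^sub>L Q)" by (simp only: S'_def op_compose_assoc)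
  finally show ?thesis by (simp add: QQ GQ)
qed

section \<open>Consequences of the Kubo-Ando axioms\<close>

lemma kubo_ando_closed: "kubo_ando_axioms \<sigma> \<Longrightarrow> positive_op A \<Longrightarrow> positive_op B \<Longrightarrow> positive_op (\<sigma> A B)"
  by (simp add: kubo_ando_axioms_def)

lemma kubo_ando_mono:
  "kubo_ando_axioms \<sigma> \<Longrightarrow> positive_op A \<Longrightarrow> positive_op B \<Longrightarrow> positive_op C \<Longrightarrow> positive_op D \<Longrightarrow>
    A \<sqsubseteq> C \<Longrightarrow> B \<sqsubseteq> D \<Longrightarrow> \<sigma> A B \<sqsubseteq> \<sigma> C D"
  unfolding kubo_ando_axioms_def by blast

lemma kubo_ando_transformer:
  "kubo_ando_axioms \<sigma> \<Longrightarrow> positive_op A \<Longrightarrow> positive_op B \<Longrightarrow> positive_op C \<Longrightarrow>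
    C o\<^sub>L \<sigma> A B o\<^sub>L C \<sqsubseteq> \<sigma> (C o\<^sub>L A o\<^sub>L C) (C o\<^sub>L B o\<^sub>L C)"
  unfolding kubo_ando_axioms_def by blast

lemma kubo_ando_id: "kubo_ando_axioms \<sigma> \<Longrightarrow> \<sigma> id_blinfun id_blinfun = id_blinfun"
  by (simp add: kubo_ando_axioms_def)

lemma cfc_conj:
  assumes X: "selfadjoint X" and c: "continuous_on (op_spectrum X) c"
  shows "cfc c X o\<^sub>L id_blinfun o\<^sub>L cfc c X = cfc (\<lambda>x. c x * c x) X"
    and "cfc c X o\<^sub>L X o\<^sub>L cfc c X = cfc (\<lambda>x. c x * x * c x) X"
proof -
  show "cfc c X o\<^sub>L id_blinfun o\<^sub>L cfc c X = cfc (\<lambda>x. c x * c x) X"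
    by (simp add: cfc_mult[OF X c c])
  have cx: "continuous_on (op_spectrum X) (\<lambda>x. c x * x)" by (intro continuous_intros c)
  show "cfc c X o\<^sub>L X o\<^sub>L cfc c X = cfc (\<lambda>x. c x * x * c x) X"
    by (simp add: cfc_mult[OF X cx c] cfc_mult[OF X c continuous_on_id] cfc_ident[OF X])
qed

text \<open>Conjugating \<open>I \<sigma> I = I\<close> by the root of \<open>m = min 1 X\<close>
  gives \<open>m \<le> m \<sigma> m\<close>, and \<open>m\<close> lies below both \<open>I\<close>
  and \<open>X\<close>.\<close>

lemma kubo_ando_ge_min:
  assumes \<sigma>: "kubo_ando_axioms \<sigma>" and X: "positive_op X"
  shows "cfc (min 1) X \<sqsubseteq> \<sigma> id_blinfun X"
proof -
  have sX: "selfadjoint X" by (rule positive_op_selfadjoint[OF X])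
  have pos: "x \<ge> 0" if "x \<in> op_spectrum X" for x using op_spectrum_nonneg[OF X that] .
  define c where "c x = sqrt (min 1 x)" for x :: real
  have cc: "continuous_on K c" for K unfolding c_def by (intro continuous_intros)
  have cmin: "continuous_on (op_spectrum X) (min 1)" by (intro continuous_intros)
  define C where "C = cfc c X"
  have C: "positive_op C" unfolding C_def by (intro positive_op_cfc sX cc) (simp add: c_def pos)
  have CC: "C o\<^sub>L id_blinfun o\<^sub>L C = cfc (min 1) X"
    unfolding C_def cfc_conj(1)[OF sX cc] by (rule cfc_cong) (simp add: c_def pos)
  have m: "positive_op (cfc (min 1) X)" by (intro positive_op_cfc sX cmin) (simp add: pos)
  have "C o\<^sub>L id_blinfun o\<^sub>L C = C o\<^sub>L \<sigma> id_blinfun id_blinfun o\<^sub>L C"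
    by (simp only: kubo_ando_id[OF \<sigma>])
  also have "\<dots> \<sqsubseteq> \<sigma> (cfc (min 1) X) (cfc (min 1) X)"
    using kubo_ando_transformer[OF \<sigma> positive_op_id positive_op_id C] by (simp only: CC)
  also have "\<dots> \<sqsubseteq> \<sigma> id_blinfun X"
  proof (rule kubo_ando_mono[OF \<sigma> m m positive_op_id X])
    show "cfc (min 1) X \<sqsubseteq> id_blinfun"
      using cfc_mono[OF sX cmin continuous_on_const, of 1] by (simp add: cfc_const[OF sX])
    show "cfc (min 1) X \<sqsubseteq> X"
      using cfc_mono[OF sX cmin continuous_on_id] by (simp add: cfc_ident[OF sX])
  qed
  finally show ?thesis by (simp only: CC)
qed

text \<open>After the transformer inequality, \<open>c \<le> 1\<close> brings the first argument
  below the identity and \<open>le\<close> brings the second below \<open>Y\<close>. It serves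
  twice: with \<open>Y = id_blinfun\<close> for the upper bound and with \<open>Y = X\<close> for
  commutation.\<close>

lemma kubo_ando_conj_le:
  assumes \<sigma>: "kubo_ando_axioms \<sigma>" and X: "positive_op X" and Y: "positive_op Y"
    and c: "continuous_on (op_spectrum X) c" "\<And>x. x \<in> op_spectrum X \<Longrightarrow> 0 \<le> c x \<and> c x \<le> 1"
    and le: "cfc (\<lambda>x. c x * x * c x) X \<sqsubseteq> Y"
  shows "cfc c X o\<^sub>L \<sigma> id_blinfun X o\<^sub>L cfc c X \<sqsubseteq> \<sigma> id_blinfun Y"
proof -
  have sX: "selfadjoint X" by (rule positive_op_selfadjoint[OF X])
  have C: "positive_op (cfc c X)" using c(2) by (intro positive_op_cfc sX c(1)) blast
  have 1: "positive_op (cfc (\<lambda>x. c x * c x) X)"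
    by (intro positive_op_cfc sX continuous_intros c(1)) simp
  have 2: "positive_op (cfc (\<lambda>x. c x * x * c x) X)"
    using c(2) op_spectrum_nonneg[OF X] by (intro positive_op_cfc sX continuous_intros c(1)) simp
  have "cfc c X o\<^sub>L \<sigma> id_blinfun X o\<^sub>L cfc c X
      \<sqsubseteq> \<sigma> (cfc (\<lambda>x. c x * c x) X) (cfc (\<lambda>x. c x * x * c x) X)"
    using kubo_ando_transformer[OF \<sigma> positive_op_id X C] by (simp only: cfc_conj[OF sX c(1)])
  also have "\<dots> \<sqsubseteq> \<sigma> id_blinfun Y"
  proof (rule kubo_ando_mono[OF \<sigma> 1 2 positive_op_id Y _ le])
    have "cfc (\<lambda>x. c x * c x) X \<sqsubseteq> cfc (\<lambda>x. 1) X"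
      using c(2) by (intro cfc_mono sX continuous_intros c(1)) (simp add: mult_le_one)
    then show "cfc (\<lambda>x. c x * c x) X \<sqsubseteq> id_blinfun" by (simp add: cfc_const[OF sX])
  qed
  finally show ?thesis .
qed

text \<open>The function \<open>c x = 1 / sqrt (max 1 x)\<close> satisfies both
  \<open>c x \<le> 1\<close> and \<open>c x * x * c x \<le> 1\<close>, so
  \<open>C (I \<sigma> X) C \<le> I \<sigma> I = I\<close>. Conjugating by the inverse
  \<open>S\<close> of \<open>C\<close> leaves \<open>S\<^sup>2 = max 1 X\<close> on the
  right.\<close>

lemma kubo_ando_le_max:
  assumes \<sigma>: "kubo_ando_axioms \<sigma>" and X: "positive_op X"
  shows "\<sigma> id_blinfun X \<sqsubseteq> cfc (max 1) X"
proof -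
  have sX: "selfadjoint X" by (rule positive_op_selfadjoint[OF X])
  have pos: "x \<ge> 0" if "x \<in> op_spectrum X" for x using op_spectrum_nonneg[OF X that] .
  define s where "s x = sqrt (max 1 x)" for x :: real
  have s1: "s x \<ge> 1" and ss: "s x * s x = max 1 x" for x by (simp_all add: s_def)
  have cs: "continuous_on K s" for K unfolding s_def by (intro continuous_intros)
  have cc: "continuous_on K (\<lambda>x. inverse (s x))" for K
    using s1 by (intro continuous_intros cs) (metis not_one_le_zero)
  define C where "C = cfc (\<lambda>x. inverse (s x)) X"
  define S where "S = cfc s X"
  have SC: "S o\<^sub>L C = id_blinfun" "C o\<^sub>L S = id_blinfun"
  proof -
    have "s x \<noteq> 0" for x using s1[of x] by auto
    then show "S o\<^sub>L C = id_blinfun" "C o\<^sub>L S = id_blinfun"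
      unfolding S_def C_def by (auto intro!: cfc_inverse sX cs cc)
  qed
  have "C o\<^sub>L \<sigma> id_blinfun X o\<^sub>L C \<sqsubseteq> \<sigma> id_blinfun id_blinfun"
    unfolding C_def
  proof (rule kubo_ando_conj_le[OF \<sigma> X positive_op_id cc])
    show "0 \<le> inverse (s x) \<and> inverse (s x) \<le> 1" for x using s1[of x] by (simp add: field_simps)
    have "inverse (s x) * x * inverse (s x) \<le> 1" for x
    proof -
      have "inverse (s x) * x * inverse (s x) = x / (s x * s x)" by (simp add: field_simps)
      also have "\<dots> \<le> 1" unfolding ss by (simp add: field_simps)
      finally show ?thesis .
    qed
    then have "cfc (\<lambda>x. inverse (s x) * x * inverse (s x)) X \<sqsubseteq> cfc (\<lambda>x. 1) X"
      by (intro cfc_mono sX continuous_intros cc)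
    then show "cfc (\<lambda>x. inverse (s x) * x * inverse (s x)) X \<sqsubseteq> id_blinfun"
      by (simp add: cfc_const[OF sX])
  qed
  then have "C o\<^sub>L \<sigma> id_blinfun X o\<^sub>L C \<sqsubseteq> id_blinfun" by (simp only: kubo_ando_id[OF \<sigma>])
  then have "S o\<^sub>L (C o\<^sub>L \<sigma> id_blinfun X o\<^sub>L C) o\<^sub>L S \<sqsubseteq> S o\<^sub>L id_blinfun o\<^sub>L S"
    by (rule op_le_conj) (simp add: S_def selfadjoint_cfc[OF sX cs])
  moreover have "S o\<^sub>L (C o\<^sub>L \<sigma> id_blinfun X o\<^sub>L C) o\<^sub>L S
      = (S o\<^sub>L C) o\<^sub>L \<sigma> id_blinfun X o\<^sub>L (C o\<^sub>L S)"
    by (simp only: op_compose_assoc)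
  moreover have "S o\<^sub>L id_blinfun o\<^sub>L S = cfc (max 1) X"
    unfolding S_def cfc_conj(1)[OF sX cs] ss ..
  ultimately show ?thesis by (simp add: SC)
qed

text \<open>For \<open>C = 1 - \<epsilon> (X - t)\<^sup>2\<close> with \<open>0 \<le> C \<le> 1\<close> the transformer inequality gives \<open>C Y C \<le> Y\<close>, where
  \<open>Y = I \<sigma> X\<close>. Expanding yields the hypothesis of \<open>commute_of_shifted_squares\<close>.\<close>

lemma kubo_ando_commute:
  fixes X :: "'a::complex_hilbert op"
  assumes \<sigma>: "kubo_ando_axioms \<sigma>" and X: "positive_op X"
    and inv: "op_invertible (\<sigma> id_blinfun X)"
  shows "X o\<^sub>L \<sigma> id_blinfun X = \<sigma> id_blinfun X o\<^sub>L X"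
proof -
  let ?Y = "\<sigma> id_blinfun X"
  have sX: "selfadjoint X" by (rule positive_op_selfadjoint[OF X])
  have Y: "positive_op ?Y" by (rule kubo_ando_closed[OF \<sigma> positive_op_id X])
  show ?thesis
  proof (rule commute_of_shifted_squares[OF sX Y inv])
    fix t and w :: 'a
    define Z where "Z = X - t *\<^sub>R id_blinfun"
    have ct: "continuous_on K (\<lambda>x. (x - t) * (x - t))" for K by (intro continuous_intros)
    have "bounded ((\<lambda>x. (x - t) * (x - t)) ` op_spectrum X)"
      by (intro compact_imp_bounded compact_continuous_image compact_op_spectrum sX ct)
    then obtain M where M: "M > 0" "\<And>x. x \<in> op_spectrum X \<Longrightarrow> (x - t) * (x - t) \<le> M"
      by (force simp: bounded_pos)
    define c where "c x = 1 - (1 / M) * ((x - t) * (x - t))" for x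
    have cc: "continuous_on K c" for K unfolding c_def by (intro continuous_intros)
    have c01: "0 \<le> c x \<and> c x \<le> 1" if "x \<in> op_spectrum X" for x
      using M(2)[OF that] M(1) by (simp add: c_def)
    have Z: "Z = cfc (\<lambda>x. x - t) X"
      unfolding Z_def using cfc_diff[OF sX continuous_on_id continuous_on_const, of t]
      by (simp add: cfc_ident[OF sX] cfc_const[OF sX])
    have czt: "continuous_on K (\<lambda>x. x - t)" for K by (intro continuous_intros)
    have "cfc (\<lambda>x. (x - t) * (x - t)) X = Z o\<^sub>L Z"
      unfolding Z by (rule cfc_mult[OF sX czt czt])
    then have C: "cfc c X = id_blinfun - (1 / M) *\<^sub>R (Z o\<^sub>L Z)"
      unfolding c_def
        cfc_diff[OF sX continuous_on_const continuous_on_mult[OF continuous_on_const ct]]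
        cfc_scaleR[OF sX ct] cfc_const[OF sX] by simp
    have "cfc c X o\<^sub>L ?Y o\<^sub>L cfc c X \<sqsubseteq> ?Y"
    proof (rule kubo_ando_conj_le[OF \<sigma> X X cc c01])
      have "cfc (\<lambda>x. c x * x * c x) X \<sqsubseteq> cfc (\<lambda>x. x) X"
      proof (intro cfc_mono sX continuous_intros cc)
        fix x assume x: "x \<in> op_spectrum X"
        have "c x * c x \<le> 1" using c01[OF x] by (simp add: mult_le_one)
        then have "(c x * c x) * x \<le> 1 * x"
          by (rule mult_right_mono) (rule op_spectrum_nonneg[OF X x])
        then show "c x * x * c x \<le> x" by (simp add: mult_ac)
      qed
      then show "cfc (\<lambda>x. c x * x * c x) X \<sqsubseteq> X" by (simp add: cfc_ident[OF sX])
    qed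
    from op_le_inner[OF this, of w]
    have "inner (cfc c X w) (?Y (cfc c X w)) \<le> inner w (?Y w)"
      using selfadjoint_inner[OF selfadjoint_cfc[OF sX cc], of w "?Y (cfc c X w)"] by simp
    moreover define v where "v = Z (Z w)"
    have "cfc c X w = w - (1 / M) *\<^sub>R v" by (simp add: C v_def blinfun.bilinear_simps)
    ultimately have "inner (w - (1 / M) *\<^sub>R v) (?Y (w - (1 / M) *\<^sub>R v)) \<le> inner w (?Y w)" by simp
    moreover have "inner (w - (1 / M) *\<^sub>R v) (?Y (w - (1 / M) *\<^sub>R v))
        = inner w (?Y w) - (2 / M) * inner v (?Y w) + (1 / M)\<^sup>2 * inner v (?Y v)"
      using selfadjoint_inner[OF positive_op_selfadjoint[OF Y], of w v]
      by (simp add: blinfun.bilinear_simps inner_diff_left inner_diff_right inner_commute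
          power2_eq_square algebra_simps)
    \<comment> \<open>The second-order term has the favourable sign, so the fixed value
      \<open>1 / M\<close> of \<open>\<epsilon>\<close> takes the place of a limit.\<close>
    moreover have "0 \<le> (1 / M)\<^sup>2 * inner v (?Y v)" using Y by (simp add: positive_op_iff)
    ultimately have "0 \<le> (2 / M) * inner v (?Y w)" by linarith
    then have "0 \<le> inner v (?Y w)" using M(1) by (simp add: zero_le_divide_iff)
    then show "0 \<le> inner ((X - t *\<^sub>R id_blinfun) ((X - t *\<^sub>R id_blinfun) w)) (?Y w)"
      by (simp only: v_def Z_def)
  qed
qed

text \<open>For invertible \<open>C\<close> the transformer inequality is an equality: apply it with
  \<open>G\<close> in one direction, and with its inverse \<open>Q\<close>, conjugated back by
  \<open>G\<close>, in the other.\<close>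

lemma kubo_ando_congruence:
  assumes \<sigma>: "kubo_ando_axioms \<sigma>" and A: "positive_op A" "op_invertible A" and B: "positive_op B"
  shows "op_powr A (-1/2) o\<^sub>L \<sigma> A B o\<^sub>L op_powr A (-1/2)
    = \<sigma> id_blinfun (op_powr A (-1/2) o\<^sub>L B o\<^sub>L op_powr A (-1/2))"
proof -
  define G where "G = op_powr A (-1/2)"
  define Q where "Q = op_powr A (1/2)"
  have pG: "positive_op G" and pQ: "positive_op Q"
    unfolding G_def Q_def by (rule positive_op_powr[OF A])+
  have QQ: "Q o\<^sub>L Q = A" and GQ: "G o\<^sub>L Q = id_blinfun" and QG: "Q o\<^sub>L G = id_blinfun"
    unfolding G_def Q_def by (rule op_powr_half[OF A])+
  have X: "positive_op (G o\<^sub>L B o\<^sub>L G)" by (intro positive_op_conj positive_op_selfadjoint pG B)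
  have "G o\<^sub>L A o\<^sub>L G = (G o\<^sub>L Q) o\<^sub>L (Q o\<^sub>L G)" unfolding QQ[symmetric] by (simp only: op_compose_assoc)
  then have GAG: "G o\<^sub>L A o\<^sub>L G = id_blinfun" by (simp add: GQ QG)
  have le: "G o\<^sub>L \<sigma> A B o\<^sub>L G \<sqsubseteq> \<sigma> id_blinfun (G o\<^sub>L B o\<^sub>L G)"
    using kubo_ando_transformer[OF \<sigma> A(1) B pG] by (simp only: GAG)
  have "Q o\<^sub>L (G o\<^sub>L B o\<^sub>L G) o\<^sub>L Q = (Q o\<^sub>L G) o\<^sub>L B o\<^sub>L (G o\<^sub>L Q)" by (simp only: op_compose_assoc)
  then have "Q o\<^sub>L (G o\<^sub>L B o\<^sub>L G) o\<^sub>L Q = B" by (simp add: GQ QG)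
  then have "Q o\<^sub>L \<sigma> id_blinfun (G o\<^sub>L B o\<^sub>L G) o\<^sub>L Q \<sqsubseteq> \<sigma> A B"
    using kubo_ando_transformer[OF \<sigma> positive_op_id X pQ] by (simp add: QQ)
  then have "G o\<^sub>L (Q o\<^sub>L \<sigma> id_blinfun (G o\<^sub>L B o\<^sub>L G) o\<^sub>L Q) o\<^sub>L G \<sqsubseteq> G o\<^sub>L \<sigma> A B o\<^sub>L G"
    by (rule op_le_conj) (rule positive_op_selfadjoint[OF pG])
  also have "G o\<^sub>L (Q o\<^sub>L \<sigma> id_blinfun (G o\<^sub>L B o\<^sub>L G) o\<^sub>L Q) o\<^sub>L G
      = (G o\<^sub>L Q) o\<^sub>L \<sigma> id_blinfun (G o\<^sub>L B o\<^sub>L G) o\<^sub>L (Q o\<^sub>L G)"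
    by (simp only: op_compose_assoc)
  finally have "\<sigma> id_blinfun (G o\<^sub>L B o\<^sub>L G) \<sqsubseteq> G o\<^sub>L \<sigma> A B o\<^sub>L G" by (simp add: GQ QG)
  then show ?thesis using op_le_antisym[OF le] by (simp only: G_def)
qed

section \<open>Means defined by the formula\<close>

lemma mat_adjoint_carrier: "A \<in> carrier_mat n m \<Longrightarrow> mat_adjoint A \<in> carrier_mat m n"
  by (auto simp: mat_adjoint_def)

lemma mat_adjoint_index:
  "A \<in> carrier_mat n m \<Longrightarrow> i < m \<Longrightarrow> j < n \<Longrightarrow> mat_adjoint A $$ (i, j) = conjugate (A $$ (j, i))"
  by (auto simp: mat_adjoint_def mat_of_rows_index)

text \<open>Given a second diagonalisation by \<open>V\<close> and \<open>e\<close>, the matrix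
  \<open>W = mat_adjoint V * U\<close> intertwines the two diagonals: \<open>W $$ (i, j)\<close> is
  zero unless \<open>d j = e i\<close>. Hence it also intertwines their images under
  \<open>f\<close>, and both diagonalisations give the same value.\<close>

lemma mat_fun_unitary_diag:
  assumes U: "unitary_mat n U"
    and M: "M = U * mat_diag n (\<lambda>i. complex_of_real (d i)) * mat_adjoint U"
  shows "mat_fun n f M = U * mat_diag n (\<lambda>i. complex_of_real (f (d i))) * mat_adjoint U"
  unfolding mat_fun_def
proof (rule the_equality)
  show "\<exists>V e. unitary_mat n V \<and>
     M = V * mat_diag n (\<lambda>i. complex_of_real (e i)) * mat_adjoint V \<and>
     U * mat_diag n (\<lambda>i. complex_of_real (f (d i))) * mat_adjoint U
       = V * mat_diag n (\<lambda>i. complex_of_real (f (e i))) * mat_adjoint V"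
    using U M by blast
next
  fix F
  assume "\<exists>V e. unitary_mat n V \<and>
     M = V * mat_diag n (\<lambda>i. complex_of_real (e i)) * mat_adjoint V \<and>
     F = V * mat_diag n (\<lambda>i. complex_of_real (f (e i))) * mat_adjoint V"
  then obtain V e where V: "unitary_mat n V"
    and MV: "M = V * mat_diag n (\<lambda>i. complex_of_real (e i)) * mat_adjoint V"
    and F: "F = V * mat_diag n (\<lambda>i. complex_of_real (f (e i))) * mat_adjoint V" by blast
  let ?D = "\<lambda>h. mat_diag n (\<lambda>i. complex_of_real (h (d i)))"
  let ?E = "\<lambda>h. mat_diag n (\<lambda>i. complex_of_real (h (e i)))"
  have c: "U \<in> carrier_mat n n" "V \<in> carrier_mat n n"
    "mat_adjoint U \<in> carrier_mat n n" "mat_adjoint V \<in> carrier_mat n n"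
    using U V by (auto simp: unitary_mat_def intro: mat_adjoint_carrier)
  have UU: "mat_adjoint U * U = 1\<^sub>m n" "U * mat_adjoint U = 1\<^sub>m n"
    and VV: "mat_adjoint V * V = 1\<^sub>m n" "V * mat_adjoint V = 1\<^sub>m n"
    using U V by (auto simp: unitary_mat_def)
  define W where "W = mat_adjoint V * U"
  have W: "W \<in> carrier_mat n n" unfolding W_def using c by simp
  have assoc: "A * B * C = A * (B * C)"
    if "A \<in> carrier_mat n n" "B \<in> carrier_mat n n" "C \<in> carrier_mat n n" for A B C :: "complex mat"
    using that by (rule assoc_mult_mat)
  have "W * ?D (\<lambda>x. x) = mat_adjoint V * M * U"
    unfolding M W_def using c UU
    by (simp add: assoc mult_carrier_mat[of _ n n _ n] right_mult_one_mat[OF mat_diag_dim])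
  also have "\<dots> = ?E (\<lambda>x. x) * W"
  proof -
    have "mat_adjoint V * M * U = (mat_adjoint V * V) * (?E (\<lambda>x. x) * (mat_adjoint V * U))"
      unfolding MV using c by (simp add: assoc mult_carrier_mat[of _ n n _ n])
    then show ?thesis
      using W by (simp add: VV W_def[symmetric] left_mult_one_mat[of _ n n] mult_carrier_mat[of _ n n _ n])
  qed
  finally have eq: "W * ?D (\<lambda>x. x) = ?E (\<lambda>x. x) * W" .
  have "W $$ (i, j) * complex_of_real (f (d j)) = complex_of_real (f (e i)) * W $$ (i, j)"
    if "i < n" "j < n" for i j
  proof -
    have "W $$ (i, j) * complex_of_real (d j) = complex_of_real (e i) * W $$ (i, j)"
      using arg_cong[OF eq, of "\<lambda>A. A $$ (i, j)"] that
      unfolding mat_diag_mult_left[OF W] mat_diag_mult_right[OF W] by simp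
    then have "W $$ (i, j) = 0 \<or> d j = e i" by (auto simp: mult.commute)
    then show ?thesis by auto
  qed
  then have eqf: "W * ?D f = ?E f * W"
    unfolding mat_diag_mult_left[OF W] mat_diag_mult_right[OF W] by (intro eq_matI) auto
  have "F = V * ?E f * (mat_adjoint V * (U * mat_adjoint U))"
    unfolding F UU using c by simp
  also have "\<dots> = V * (?E f * W) * mat_adjoint U"
    unfolding W_def using c by (simp add: assoc mult_carrier_mat[of _ n n _ n])
  also have "\<dots> = V * (W * ?D f) * mat_adjoint U" by (simp only: eqf)
  also have "\<dots> = (V * mat_adjoint V) * U * ?D f * mat_adjoint U"
    unfolding W_def using c by (simp add: assoc mult_carrier_mat[of _ n n _ n])
  also have "\<dots> = U * ?D f * mat_adjoint U" unfolding VV using c by simp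
  finally show "F = U * ?D f * mat_adjoint U" .
qed

text \<open>All tests of operator monotonicity below use this shape. The entries are real but
  embedded in the complex numbers, as \<open>psd_mat\<close> requires; real rotations diagonalise
  such matrices.\<close>

definition sym2 :: "real \<Rightarrow> real \<Rightarrow> real \<Rightarrow> complex mat" where
  "sym2 p q r = Matrix.mat 2 2
     (\<lambda>(i, j). complex_of_real (if i \<noteq> j then q else if i = 0 then p else r))"

lemma sum_2: "(\<Sum>i\<in>{0..<2::nat}. g i) = g 0 + (g 1 :: 'b::comm_monoid_add)"
  by (simp add: numeral_2_eq_2)

lemma sym2_carrier [simp]: "sym2 p q r \<in> carrier_mat 2 2"
  by (simp add: sym2_def)

lemma sym2_diff: "sym2 p q r - sym2 p' q' r' = sym2 (p - p') (q - q') (r - r')"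
  by (intro eq_matI) (auto simp: sym2_def)

lemma re_quadratic_form_sym2:
  assumes v: "v \<in> carrier_vec 2"
  shows "Re ((sym2 p q r *\<^sub>v v) \<bullet>c v) = p * (cmod (vec_index v 0))\<^sup>2
    + 2 * q * Re (vec_index v 0 * cnj (vec_index v 1)) + r * (cmod (vec_index v 1))\<^sup>2"
proof -
  have "dim_vec v = 2" using v by simp
  then have "(sym2 p q r *\<^sub>v v) \<bullet>c v
    = (of_real p * vec_index v 0 + of_real q * vec_index v 1) * cnj (vec_index v 0)
    + (of_real q * vec_index v 0 + of_real r * vec_index v 1) * cnj (vec_index v 1)"
    by (simp add: sym2_def scalar_prod_def mult_mat_vec_def sum_2 conjugate_complex_def
        flip: One_nat_def)
  then show ?thesis unfolding cmod_power2 by (simp add: power2_eq_square algebra_simps)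
qed

text \<open>Completing the square: \<open>p\<close> times the quadratic form is a squared modulus
  plus the determinant times another squared modulus.\<close>

lemma psd_mat_sym2:
  assumes p: "0 < p" and det: "q\<^sup>2 \<le> p * r"
  shows "psd_mat 2 (sym2 p q r)"
  unfolding psd_mat_def
proof (intro conjI ballI)
  show "mat_adjoint (sym2 p q r) = sym2 p q r"
    using mat_adjoint_carrier[OF sym2_carrier, of p q r] carrier_matD[OF sym2_carrier, of p q r]
    by (intro eq_matI)
      (auto simp: mat_adjoint_index[OF sym2_carrier] conjugate_complex_def, auto simp: sym2_def)
  fix v :: "complex vec" assume v: "v \<in> carrier_vec 2"
  let ?x = "vec_index v 0" and ?y = "vec_index v 1"
  have "p * Re ((sym2 p q r *\<^sub>v v) \<bullet>c v)
      = (cmod (of_real p * ?x + of_real q * ?y))\<^sup>2 + (p * r - q\<^sup>2) * (cmod ?y)\<^sup>2"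
    unfolding re_quadratic_form_sym2[OF v] cmod_power2
    by (simp add: power2_eq_square algebra_simps)
  also have "\<dots> \<ge> 0" using det by simp
  finally show "0 \<le> Re ((sym2 p q r *\<^sub>v v) \<bullet>c v)" using p by (simp add: zero_le_mult_iff)
qed simp

lemma psd_mat_sym2_corner:
  assumes "psd_mat 2 (sym2 p q r)"
  shows "0 \<le> p"
proof -
  define v where "v = Matrix.vec 2 (\<lambda>i. if i = 0 then 1 else 0 :: complex)"
  have "v \<in> carrier_vec 2" "vec_index v 0 = 1" "vec_index v 1 = 0" by (auto simp: v_def)
  then show ?thesis
    using assms re_quadratic_form_sym2[of v p q r] by (force simp: psd_mat_def)
qed

lemma invertible_mat_sym2:
  assumes "p * r - q\<^sup>2 \<noteq> 0"
  shows "invertible_mat (sym2 p q r)"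
proof -
  define d where "d = p * r - q\<^sup>2"
  have d: "d \<noteq> 0" using assms by (simp add: d_def)
  have "p * (r / d) + q * (- q / d) = (p * r - q\<^sup>2) / d" "q * (- q / d) + r * (p / d) = (p * r - q\<^sup>2) / d"
    by (simp_all add: diff_divide_distrib power2_eq_square mult.commute)
  then have inv: "p * (r / d) + q * (- q / d) = 1" "p * (- q / d) + q * (p / d) = 0"
    "q * (r / d) + r * (- q / d) = 0" "q * (- q / d) + r * (p / d) = 1"
    using d by (simp_all flip: d_def add: mult.commute)
  have prod: "sym2 p q r * sym2 p' q' r' = 1\<^sub>m 2"
    if "p * p' + q * q' = 1" "p * q' + q * r' = 0" "q * p' + r * q' = 0" "q * q' + r * r' = 1"
    for p q r p' q' r'
    using that
    by (intro eq_matI) (auto simp: sym2_def scalar_prod_def sum_2 less_2_cases_iff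
        simp flip: of_real_mult of_real_add)
  have "sym2 p q r * sym2 (r / d) (- q / d) (p / d) = 1\<^sub>m 2"
    by (rule prod) (rule inv)+
  moreover have "sym2 (r / d) (- q / d) (p / d) * sym2 p q r = 1\<^sub>m 2"
    by (rule prod) (use inv in \<open>simp_all add: mult.commute add.commute\<close>)
  ultimately show ?thesis
    unfolding invertible_mat_def inverts_mat_def square_mat.simps
    using carrier_matD[OF sym2_carrier] by auto
qed

text \<open>The argument is the diagonal matrix of \<open>a\<close> and \<open>b\<close> conjugated
  by the rotation with cosine \<open>c\<close> and sine \<open>s\<close>.\<close>

lemma mat_fun_sym2:
  assumes cs: "c\<^sup>2 + s\<^sup>2 = 1"
  shows "mat_fun 2 f (sym2 (c\<^sup>2 * a + s\<^sup>2 * b) (c * s * (a - b)) (s\<^sup>2 * a + c\<^sup>2 * b))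
    = sym2 (c\<^sup>2 * f a + s\<^sup>2 * f b) (c * s * (f a - f b)) (s\<^sup>2 * f a + c\<^sup>2 * f b)"
proof -
  define U where "U = Matrix.mat 2 2
    (\<lambda>(i, j). complex_of_real (if i = j then c else if i = 0 then - s else s))"
  have U: "U \<in> carrier_mat 2 2" by (simp add: U_def)
  have U': "mat_adjoint U = Matrix.mat 2 2
    (\<lambda>(i, j). complex_of_real (if i = j then c else if i = 0 then s else - s))"
    using mat_adjoint_carrier[OF U]
    by (intro eq_matI)
      (auto simp: mat_adjoint_index[OF U] conjugate_complex_def, auto simp: U_def)
  have cs': "complex_of_real c * complex_of_real c + complex_of_real s * complex_of_real s = 1"
    using arg_cong[OF cs, of complex_of_real] by (simp add: power2_eq_square)
  have unitary: "unitary_mat 2 U"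
    unfolding unitary_mat_def U' using cs' U
    by (auto intro!: eq_matI simp: U_def scalar_prod_def sum_2 less_2_cases_iff add.commute)
  have diag: "U * mat_diag 2 (\<lambda>i. complex_of_real (d i)) * mat_adjoint U
    = sym2 (c\<^sup>2 * d 0 + s\<^sup>2 * d 1) (c * s * (d 0 - d 1)) (s\<^sup>2 * d 0 + c\<^sup>2 * d 1)" for d
    unfolding mat_diag_mult_right[OF U] U'
    by (intro eq_matI)
      (auto simp: U_def sym2_def scalar_prod_def sum_2 less_2_cases_iff power2_eq_square algebra_simps)
  show ?thesis
    using mat_fun_unitary_diag[OF unitary diag[of "\<lambda>i. if i = 0 then a else b", symmetric], of f]
      diag[of "\<lambda>i. f (if i = 0 then a else b)"] by simp
qed

lemma mat_fun_sym2_diag: "mat_fun 2 f (sym2 a 0 b) = sym2 (f a) 0 (f b)"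
  using mat_fun_sym2[of 1 0 f a b] by simp

text \<open>The strict determinant conditions yield invertibility; \<open>p < p'\<close> is strict
  because \<open>psd_mat_sym2\<close> is applied to the difference, whose corner must be
  positive.\<close>

lemma operator_monotoneD_sym2:
  assumes f: "operator_monotone f"
    and X: "0 < p" "q\<^sup>2 < p * r" and Y: "0 < p'" "q'\<^sup>2 < p' * r'"
    and le: "p < p'" "(q' - q)\<^sup>2 \<le> (p' - p) * (r' - r)"
  shows "psd_mat 2 (mat_fun 2 f (sym2 p' q' r') - mat_fun 2 f (sym2 p q r))"
  using f[unfolded operator_monotone_def, rule_format, of 2 "sym2 p q r" "sym2 p' q' r'"] assms
  by (simp add: psd_mat_sym2 invertible_mat_sym2 sym2_diff)

section \<open>Scalar consequences of operator monotonicity\<close>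

lemma operator_monotone_mono:
  assumes f: "operator_monotone f" and "0 < x" "x \<le> y"
  shows "f x \<le> f y"
proof (cases "x = y")
  case False
  then have "psd_mat 2 (mat_fun 2 f (sym2 y 0 y) - mat_fun 2 f (sym2 x 0 x))"
    using assms by (intro operator_monotoneD_sym2[OF f]) auto
  then have "psd_mat 2 (sym2 (f y - f x) 0 (f y - f x))"
    by (simp add: mat_fun_sym2_diag sym2_diff)
  then show ?thesis using psd_mat_sym2_corner by fastforce
qed simp

text \<open>Rotating \<open>diag(a, \<delta>)\<close> gives a matrix with corner entry \<open>p = k a + (1 - k) \<delta> < s\<close>, dominated by
  \<open>diag(s, R)\<close> for large \<open>R\<close>. Comparing corners after applying \<open>f\<close> gives \<open>k f(a) + (1 - k) f(\<delta>) \<le> f(s)\<close>.\<close>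

lemma operator_monotone_ratio:
  assumes f: "operator_monotone f" and nonneg: "\<And>x. 0 < x \<Longrightarrow> 0 \<le> f x" and s: "0 < s" "s < a"
  shows "s * f a \<le> a * f s"
proof -
  have a: "a > 0" using s by simp
  have main: "k * f a \<le> f s" if k: "0 < k" "k < s / a" for k
  proof -
    have k1: "k < 1" using k s a by (meson divide_less_eq_1_pos less_trans)
    have ka: "k * a < s" using k a by (simp add: field_simps)
    \<comment> \<open>Half of the gap between \<open>k * a\<close> and \<open>s\<close>, so that
      \<open>p \<le> k * a + \<delta> < s\<close>.\<close>
    define \<delta> where "\<delta> = (s - k * a) / 2"
    have \<delta>: "\<delta> > 0" using ka by (simp add: \<delta>_def)
    define c t where "c = sqrt k" and "t = sqrt (1 - k)"
    have ct: "c\<^sup>2 = k" "t\<^sup>2 = 1 - k" using k k1 by (simp_all add: c_def t_def)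
    then have ct1: "c\<^sup>2 + t\<^sup>2 = 1" by simp
    define p q r where "p = c\<^sup>2 * a + t\<^sup>2 * \<delta>" and "q = c * t * (a - \<delta>)"
      and "r = t\<^sup>2 * a + c\<^sup>2 * \<delta>"
    have p: "p > 0" using k k1 a \<delta> by (simp add: p_def ct add_pos_pos)
    have "(1 - k) * \<delta> \<le> \<delta>" using k \<delta> by (simp add: algebra_simps)
    then have e: "p < s" using ka unfolding p_def ct \<delta>_def by (simp add: field_simps)
    have q: "q\<^sup>2 = k * (1 - k) * (a - \<delta>)\<^sup>2" by (simp add: q_def power_mult_distrib ct)
    have "p * r - q\<^sup>2 = a * \<delta>"
      unfolding q p_def r_def ct by (simp add: power2_eq_square algebra_simps)
    then have det: "q\<^sup>2 < p * r" using a \<delta> by (metis diff_gt_0_iff_gt mult_pos_pos)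
    have r: "r > 0" using k k1 a \<delta> by (simp add: r_def ct add_pos_pos)
    \<comment> \<open>Chosen so that \<open>(s - p) * (R - r) = q\<^sup>2\<close>: the difference
      from \<open>sym2 s 0 R\<close> then has determinant zero, just enough for positivity.\<close>
    define R where "R = r + q\<^sup>2 / (s - p)"
    have R: "R > 0" using r e by (simp add: R_def add_pos_nonneg)
    have "psd_mat 2 (mat_fun 2 f (sym2 s 0 R) - mat_fun 2 f (sym2 p q r))"
      using e by (intro operator_monotoneD_sym2[OF f p det s(1)]) (simp_all add: R_def R[unfolded R_def] s)
    then have "psd_mat 2 (sym2 (f s - (c\<^sup>2 * f a + t\<^sup>2 * f \<delta>)) (0 - c * t * (f a - f \<delta>))
        (f R - (t\<^sup>2 * f a + c\<^sup>2 * f \<delta>)))"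
      unfolding p_def q_def r_def by (simp only: mat_fun_sym2_diag mat_fun_sym2[OF ct1] sym2_diff)
    then have "k * f a + (1 - k) * f \<delta> \<le> f s"
      using psd_mat_sym2_corner unfolding ct by fastforce
    moreover have "0 \<le> (1 - k) * f \<delta>" using k1 nonneg[OF \<delta>] by simp
    ultimately show ?thesis by simp
  qed
  \<comment> \<open>At \<open>k = s / a\<close> the eigenvalue \<open>\<delta>\<close> would be 0,
    so this value is reached only as a limit from below.\<close>
  have "s / a * f a \<le> f s"
  proof (rule field_le_mult_one_interval)
    fix z :: real assume z: "0 < z" "z < 1"
    then have "z * (s / a) < 1 * (s / a)" using s a by (intro mult_strict_right_mono) auto
    then show "z * (s / a * f a) \<le> f s"
      using main[of "z * (s / a)"] z s a by (simp add: mult.assoc)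
  qed
  then show ?thesis using a by (simp add: field_simps)
qed

text \<open>\<open>f y\<close> lies between \<open>f x\<close> and \<open>(y / x) * f x\<close>, by
  monotonicity and the ratio inequality. Continuity is what admits \<open>f\<close> to the
  functional calculus.\<close>

lemma operator_monotone_continuous_on:
  assumes f: "operator_monotone f" and nonneg: "\<And>x. 0 < x \<Longrightarrow> 0 \<le> f x" and S: "S \<subseteq> {0<..}"
  shows "continuous_on S f"
  unfolding continuous_on_def
proof
  fix x assume "x \<in> S"
  then have x: "x > 0" using S by auto
  have bound: "norm (f y - f x) \<le> f x * (\<bar>y - x\<bar> / x)" if "y \<in> S" for y
  proof -
    have y: "y > 0" using S that by auto
    consider "y < x" | "y = x" | "x < y" by linarith
    then show ?thesis
    proof cases
      case 1
      then have "f y \<le> f x" "y * f x \<le> x * f y"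
        using operator_monotone_mono[OF f y, of x] operator_monotone_ratio[OF f nonneg y, of x] by auto
      then show ?thesis using x 1 by (simp add: field_simps)
    next
      case 3
      then have "f x \<le> f y" "x * f y \<le> y * f x"
        using operator_monotone_mono[OF f x, of y] operator_monotone_ratio[OF f nonneg x, of y] by auto
      then show ?thesis using x 3 by (simp add: field_simps)
    qed simp
  qed
  have "((\<lambda>y. f x * (\<bar>y - x\<bar> / x)) \<longlongrightarrow> f x * (\<bar>x - x\<bar> / x)) (at x within S)"
    using x by (intro tendsto_intros) auto
  then have lim: "((\<lambda>y. f x * (\<bar>y - x\<bar> / x)) \<longlongrightarrow> 0) (at x within S)" by simp
  have "\<forall>\<^sub>F y in at x within S. norm (f y - f x) \<le> f x * (\<bar>y - x\<bar> / x)"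
    unfolding eventually_at_filter by (intro always_eventually) (use bound in blast)
  then have "((\<lambda>y. f y - f x) \<longlongrightarrow> 0) (at x within S)"
    by (rule Lim_null_comparison[OF _ lim])
  then show "(f \<longlongrightarrow> f x) (at x within S)" by (rule LIM_zero_cancel)
qed

lemma operator_monotone_bounds:
  assumes f: "operator_monotone f" and nonneg: "\<And>x. 0 < x \<Longrightarrow> 0 \<le> f x" and 1: "f 1 = 1" and x: "0 < x"
  shows "min 1 x \<le> f x" "f x \<le> max 1 x"
proof -
  have "x \<le> f x" "f x \<le> 1" if "x < 1"
    using operator_monotone_mono[OF f x, of 1] operator_monotone_ratio[OF f nonneg x that] that
    by (auto simp: 1)
  moreover have "1 \<le> f x" "f x \<le> x" if "1 < x"
    using operator_monotone_mono[OF f, of 1 x] operator_monotone_ratio[OF f nonneg _ that] that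
    by (auto simp: 1)
  ultimately show "min 1 x \<le> f x" "f x \<le> max 1 x"
    by (cases x "1 :: real" rule: linorder_cases; simp add: 1)+
qed

section \<open>The two kinds of mean brought together\<close>

lemma cfc_min_one:
  assumes X: "positive_op X" "op_invertible X"
  shows "positive_op (cfc (min 1) X)" "op_invertible (cfc (min 1) X)"
proof -
  have sX: "selfadjoint X" by (rule positive_op_selfadjoint[OF X(1)])
  have c: "continuous_on (op_spectrum X) (min 1)" by (intro continuous_intros)
  have pos: "0 < min 1 x" if "x \<in> op_spectrum X" for x using op_spectrum_pos[OF X that] by simp
  show "positive_op (cfc (min 1) X)" "op_invertible (cfc (min 1) X)"
    using positive_op_cfc[OF sX c] op_invertible_cfc[OF sX c] pos less_imp_le less_imp_neq by metis+
qed

text \<open>Here the definitions for finite and infinite dimension meet: \<open>Y\<close> is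
  \<open>cfc f X\<close> in the first case and \<open>\<sigma> id_blinfun X\<close> in the second,
  and both share the properties that the logarithm estimate uses.\<close>

lemma kubo_ando_mean_between:
  fixes A B :: "'a::complex_hilbert op"
  assumes A: "positive_op A" "op_invertible A" and B: "positive_op B" "op_invertible B"
    and \<sigma>: "kubo_ando_mean \<sigma>"
  defines "X \<equiv> op_powr A (-1/2) o\<^sub>L B o\<^sub>L op_powr A (-1/2)"
  defines "Y \<equiv> op_powr A (-1/2) o\<^sub>L \<sigma> A B o\<^sub>L op_powr A (-1/2)"
  shows "positive_op X \<and> op_invertible X \<and> selfadjoint Y \<and> X o\<^sub>L Y = Y o\<^sub>L X \<and>
    cfc (min 1) X \<sqsubseteq> Y \<and> Y \<sqsubseteq> cfc (max 1) X"
proof -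
  have X: "positive_op X"
    unfolding X_def by (intro positive_op_conj positive_op_selfadjoint positive_op_powr A B)
  have Xinv: "op_invertible X"
    unfolding X_def by (intro op_invertible_compose op_invertible_powr_half A B)
  have sX: "selfadjoint X" by (rule positive_op_selfadjoint[OF X])
  have pX: "x > 0" if "x \<in> op_spectrum X" for x using op_spectrum_pos[OF X Xinv that] .
  have cmin: "continuous_on (op_spectrum X) (min 1)" and cmax: "continuous_on (op_spectrum X) (max 1)"
    by (intro continuous_intros)+
  show ?thesis
  proof (cases "finite_dim TYPE('a)")
    case True
    then obtain f where f: "operator_monotone f" "\<And>x. x > 0 \<Longrightarrow> 0 \<le> f x" "f 1 = 1"
      and formula: "\<sigma> A B = op_powr A (1/2) o\<^sub>L cfc f X o\<^sub>L op_powr A (1/2)"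
      using \<sigma> A B unfolding kubo_ando_mean_def kubo_ando_formula_def X_def by auto
    have cf: "continuous_on (op_spectrum X) f"
      by (rule operator_monotone_continuous_on[OF f(1,2)]) (use pX in auto)
    have "Y = (op_powr A (-1/2) o\<^sub>L op_powr A (1/2)) o\<^sub>L cfc f X o\<^sub>L
        (op_powr A (1/2) o\<^sub>L op_powr A (-1/2))"
      unfolding Y_def formula by (simp only: op_compose_assoc)
    then have Y: "Y = cfc f X" by (simp only: op_powr_half[OF A] id_compose)
    show ?thesis
      unfolding Y using pX
      by (intro conjI X Xinv selfadjoint_cfc sX cf cfc_commute refl cfc_mono cmin cmax
          operator_monotone_bounds[OF f])
  next
    case False
    then have ax: "kubo_ando_axioms \<sigma>" using \<sigma> by (simp add: kubo_ando_mean_def)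
    have Y: "Y = \<sigma> id_blinfun X"
      unfolding Y_def X_def by (rule kubo_ando_congruence[OF ax A B(1)])
    have pY: "positive_op Y" unfolding Y by (rule kubo_ando_closed[OF ax positive_op_id X])
    have lo: "cfc (min 1) X \<sqsubseteq> Y" unfolding Y by (rule kubo_ando_ge_min[OF ax X])
    have "op_invertible Y"
      by (rule op_invertible_mono[OF cfc_min_one[OF X Xinv] positive_op_selfadjoint[OF pY] lo])
    then have "X o\<^sub>L Y = Y o\<^sub>L X" unfolding Y by (rule kubo_ando_commute[OF ax X])
    moreover have "Y \<sqsubseteq> cfc (max 1) X" unfolding Y by (rule kubo_ando_le_max[OF ax X])
    ultimately show ?thesis using X Xinv lo positive_op_selfadjoint[OF pY] by blast
  qed
qed

theorem theorem5:
  fixes A B :: "'a::complex_hilbert \<Rightarrow>\<^sub>L 'a"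
    and \<sigma> :: "('a \<Rightarrow>\<^sub>L 'a) \<Rightarrow> ('a \<Rightarrow>\<^sub>L 'a) \<Rightarrow> ('a \<Rightarrow>\<^sub>L 'a)"
  assumes "positive_op A" and "op_invertible A"
    and "positive_op B" and "op_invertible B"
    and "kubo_ando_mean \<sigma>"
  shows "trace_dist A (\<sigma> A B) \<le> trace_dist A B"
proof -
  define X where "X = op_powr A (-1/2) o\<^sub>L B o\<^sub>L op_powr A (-1/2)"
  define Y where "Y = op_powr A (-1/2) o\<^sub>L \<sigma> A B o\<^sub>L op_powr A (-1/2)"
  have X: "positive_op X" "op_invertible X" and sY: "selfadjoint Y" and comm: "X o\<^sub>L Y = Y o\<^sub>L X"
    and lo: "cfc (min 1) X \<sqsubseteq> Y" and hi: "Y \<sqsubseteq> cfc (max 1) X"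
    using kubo_ando_mean_between[OF assms] by (simp_all only: X_def Y_def)
  have sX: "selfadjoint X" by (rule positive_op_selfadjoint[OF X(1)])
  \<comment> \<open>Both properties are inherited from the positive invertible lower bound
    \<open>cfc (min 1) X\<close>, which makes the spectrum of \<open>Y\<close> positive and its
    logarithm meaningful.\<close>
  have Y: "positive_op Y" "op_invertible Y"
    using op_invertible_mono[OF cfc_min_one[OF X] sY lo] positive_op_mono[OF cfc_min_one(1)[OF X] lo] by simp_all
  have "hs_norm (op_log Y) \<le> hs_norm (op_log X)"
  proof (rule hs_norm_mono)
    show "selfadjoint (op_log X)" "selfadjoint (op_log Y)"
      unfolding op_log_def
      by (intro selfadjoint_cfc sX sY continuous_intros;
          use op_spectrum_pos[OF X] op_spectrum_pos[OF Y] in force)+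
    show "norm (op_log Y z) \<le> norm (op_log X z)" for z
      by (rule norm_op_log_le[OF X Y comm lo hi])
  qed
  then show ?thesis by (simp only: trace_dist_def X_def Y_def)
qed

end
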